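(* There exists a constant $c^*>0$, with numerical value $c^*\approx 4.10938818$, such that the following holds. For $\hat c>0$ and $n\ge1$, let $x_{1,3n}<\dots<x_{3n,3n}$ be the zeros of the multiple Hermite polynomial $H_{n,n,n}$ with parameter $c=\sqrt n\,\hat c$. Then there is a probability density $v$ on $\mathbb{R}$ (depending on $\hat c$) such that for every bounded continuous function $f:\mathbb{R}\to\mathbb{R}$ \[ \lim_{n\to\infty}\frac{1}{3n}\sum_{j=1}^{3n} f\!\left(\frac{x_{j,3n}}{\sqrt n}\right)=\int f(x)\,v(x)\,dx . \] Moreover, if $\hat c>c^*$, then $v$ is supported on three intervals $[-b,-a]\cup[-d,d]\cup[a,b]$ for some $0<d<a<b$; and if $\hat c<c^*$, then $v$ is supported on one interval $[-b,b]$ for some $b>0$.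
   Context: For $c>0$ let $w_1(x)=e^{-x^2-cx}$, $w_2(x)=e^{-x^2}$, $w_3(x)=e^{-x^2+cx}$ on $\mathbb{R}$. The multiple Hermite polynomial $H_{n,n,n}$ (with parameters $c_1=-c$, $c_2=0$, $c_3=c$) is the unique monic polynomial of degree $3n$ such that $\int_{-\infty}^{\infty} x^k H_{n,n,n}(x)\,w_j(x)\,dx=0$ for all $0\le k\le n-1$ and $j=1,2,3$. It has $3n$ simple real zeros. "Supported on" a set means that this set is the support of the measure $v(x)\,dx$. *)

theory Defs
  imports "HOL-Probability.Probability" "HOL-Computational_Algebra.Polynomial"
begin

definition hermite_weight :: "real \<Rightarrow> real \<Rightarrow> real" where
  "hermite_weight \<gamma> x = exp (- (x ^ 2) + \<gamma> * x)"

definition is_multiple_hermite :: "nat \<Rightarrow> real \<Rightarrow> real poly \<Rightarrow> bool" where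
  "is_multiple_hermite n c p \<longleftrightarrow>
     degree p = 3 * n \<and> lead_coeff p = 1 \<and>
     (\<forall>\<gamma>\<in>{- c, 0, c}. \<forall>k<n.
        integrable lborel (\<lambda>x. x ^ k * poly p x * hermite_weight \<gamma> x) \<and>
        (\<integral>x. x ^ k * poly p x * hermite_weight \<gamma> x \<partial>lborel) = 0)"

text \<open>
  The polynomial \<open>H\<^bsub>n,n,n\<^esub>\<close> with parameters \<open>-c, 0, c\<close>. It is unique for \<open>c > 0\<close> only:
  at \<open>c = 0\<close> the three orthogonality conditions coincide.
\<close>
definition multiple_hermite :: "nat \<Rightarrow> real \<Rightarrow> real poly" where
  "multiple_hermite n c = (THE p. is_multiple_hermite n c p)"

definition prob_density :: "(real \<Rightarrow> real) \<Rightarrow> bool" where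
  "prob_density v \<longleftrightarrow>
     v \<in> borel_measurable borel \<and> (\<forall>x. 0 \<le> v x) \<and> has_bochner_integral lborel v 1"

text \<open>
  The topological support of a Borel measure. This differs from the set where a density is
  nonzero, which is only determined up to null sets.
\<close>
definition measure_support :: "'a::topological_space measure \<Rightarrow> 'a set" where
  "measure_support M = {x. \<forall>U. open U \<longrightarrow> x \<in> U \<longrightarrow> emeasure M U > 0}"

definition density_support :: "(real \<Rightarrow> real) \<Rightarrow> real set" where
  "density_support v = measure_support (density lborel (\<lambda>x. ennreal (v x)))"

end

theory Submission
  imports Defs "HOL-Computational_Algebra.Fundamental_Theorem_Algebra"
    "HOL-Real_Asymp.Real_Asymp"
begin

text \<open>
  The operators \<open>p \<mapsto> (x - \<alpha>) p - t p'\<close> commute, and applying each of them with \<open>t = 1/2\<close> and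
  \<open>\<alpha> \<in> {-c/2, 0, c/2}\<close> exactly \<open>n\<close> times to \<open>1\<close> gives \<open>H\<^bsub>n,n,n\<^esub>\<close> (Rodrigues formula). Each
  operator preserves the property of having only simple real zeros.

  Rescale by \<open>sqrt n\<close>, so that \<open>t = 1/(2n)\<close> and \<open>A = {-a, 0, a}\<close> with \<open>a = ch/2\<close>. Let \<open>P\<close> be the
  rescaled polynomial, \<open>u = P'/(nP)\<close>, and \<open>Q\<^sub>\<alpha>\<close> the polynomial with one factor \<open>\<alpha>\<close> left out. Then
  \<open>P' = n \<Sum>\<^sub>\<alpha> Q\<^sub>\<alpha>\<close> and \<open>P = (z - \<alpha>) Q\<^sub>\<alpha> - t Q\<^sub>\<alpha>'\<close>, and the logarithmic derivatives of \<open>P\<close> and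
  \<open>Q\<^sub>\<alpha>\<close> differ by \<open>O(1)\<close> on the upper half-plane. Hence \<open>u = \<Sum>\<^sub>\<alpha> 1/(z - u/2 - \<alpha>) + O(1/n)\<close>, that is,
  \<open>w = z - u/2\<close> satisfies \<open>\<psi>(w) = z + O(1/n)\<close> for \<open>\<psi>(w) = w + (\<Sum>\<^sub>\<alpha> 1/(w - \<alpha>))/2\<close>.

  By the equality case of the Cauchy-Schwarz inequality \<open>\<psi>\<close> is injective on
  \<open>{Im w \<ge> 0, (\<Sum>\<^sub>\<alpha> 1/|w - \<alpha>|\<^sup>2)/2 \<le> 1}\<close>. It is also proper there, so its inverse \<open>\<omega>\<close> is continuous
  on the closed upper half-plane. Therefore \<open>u \<rightarrow> 2(z - \<omega>(z))\<close>, and the limiting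
  zero distribution has the continuous density \<open>2 Im \<omega>(x) / (3\<pi>)\<close>. This density vanishes exactly on
  the \<open>\<psi>\<close>-image of the real \<open>w\<close> with \<open>(\<Sum>\<^sub>\<alpha> 1/(w - \<alpha>)\<^sup>2)/2 \<le> 1\<close>. On \<open>(0, a)\<close> the left side is convex,
  with minimum \<open>gap_min/(2a\<^sup>2)\<close>, so the phase transition is at \<open>ch\<^sup>2 = 2 gap_min\<close>.
\<close>

section \<open>Raising operators and simple real zeros\<close>

text \<open>Up to the factor \<open>-t\<close> this is the Rodrigues operator
  \<open>p \<mapsto> e^f (e^(-f) p)'\<close> with \<open>f = (x - \<alpha>)\<^sup>2 / (2 t)\<close>.
  For \<open>t = 1/2\<close> the factor \<open>e^(-f)\<close> is a constant multiple of
  \<open>exp (- x\<^sup>2 + 2 \<alpha> x)\<close>. The coefficient type is left open because the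
  operator is used over the reals and over the complex numbers.\<close>

definition raise :: "'a::idom \<Rightarrow> 'a \<Rightarrow> 'a poly \<Rightarrow> 'a poly" where
  "raise t \<alpha> p = [:- \<alpha>, 1:] * p - smult t (pderiv p)"

text \<open>Since the operators commute, only the multiplicity of each \<alpha> matters; with a
  multiset a single factor can also be left out.\<close>

definition herm :: "'a::idom \<Rightarrow> 'a multiset \<Rightarrow> 'a poly" where
  "herm t M = fold_mset (raise t) 1 M"

lemma raise_add: "raise t \<alpha> (p + q) = raise t \<alpha> p + raise t \<alpha> q"
  by (simp add: raise_def pderiv_add smult_add_right algebra_simps)

lemma raise_0 [simp]: "raise t \<alpha> 0 = 0"
  by (simp add: raise_def)

lemma raise_smult: "raise t \<alpha> (smult c p) = smult c (raise t \<alpha> p)"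
  by (simp add: raise_def pderiv_smult smult_diff_right mult.commute)

lemma raise_sum_mset: "raise t \<alpha> (\<Sum>x\<in>#M. f x) = (\<Sum>x\<in>#M. raise t \<alpha> (f x))"
  by (induction M) (simp_all add: raise_add)

text \<open>For equal \<open>t\<close> the two operators differ by multiplication with the constant
  \<beta> - \<alpha>, so they commute. This makes the fold over a multiset well defined.\<close>

lemma raise_commute: "raise t \<alpha> (raise t \<beta> p) = raise t \<beta> (raise t \<alpha> p)"
  by (simp only: raise_def pderiv_diff pderiv_mult pderiv_smult)
    (simp add: pderiv_pCons pderiv_add pderiv_smult smult_diff_right smult_add_right algebra_simps)

lemma herm_empty [simp]: "herm t {#} = 1"
  by (simp add: herm_def)

lemma herm_add_mset: "herm t (add_mset \<alpha> M) = raise t \<alpha> (herm t M)"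
proof -
  interpret comp_fun_commute "raise t"
    by standard (simp add: fun_eq_iff raise_commute)
  show ?thesis by (simp add: herm_def)
qed

text \<open>The commutator of differentiation and \<open>raise\<close> is the identity.\<close>

lemma pderiv_raise: "pderiv (raise t \<alpha> p) = p + raise t \<alpha> (pderiv p)"
  by (simp only: raise_def pderiv_diff pderiv_mult pderiv_smult)
    (simp add: pderiv_pCons algebra_simps)

text \<open>Moving the derivative through the operators one by one, each commutator deletes one
  operator, and the derivative of the initial \<open>1\<close> vanishes.\<close>

lemma pderiv_herm: "pderiv (herm t M) = (\<Sum>\<alpha>\<in>#M. herm t (M - {#\<alpha>#}))"
proof (induction M)
  case (add \<alpha> M)
  have "(\<Sum>\<beta>\<in>#M. raise t \<alpha> (herm t (M - {#\<beta>#}))) =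
      (\<Sum>\<beta>\<in>#M. herm t (add_mset \<alpha> M - {#\<beta>#}))"
    by (intro arg_cong[of _ _ sum_mset] image_mset_cong)
      (simp flip: herm_add_mset)
  then show ?case
    by (simp add: herm_add_mset pderiv_raise add.IH raise_sum_mset)
qed simp

lemma degree_raise:
  assumes "p \<noteq> 0"
  shows "degree (raise t \<alpha> p) = Suc (degree p)" "lead_coeff (raise t \<alpha> p) = lead_coeff p"
proof -
  have *: "coeff (raise t \<alpha> p) (Suc (degree p)) = lead_coeff p"
    by (simp add: raise_def coeff_pderiv coeff_eq_0)
  have "degree (raise t \<alpha> p) \<le> Suc (degree p)"
    by (rule degree_le)
      (auto simp: raise_def coeff_pderiv coeff_pCons coeff_eq_0 split: nat.splits)
  moreover have "degree (raise t \<alpha> p) \<ge> Suc (degree p)"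
    by (rule le_degree) (use * assms in simp)
  ultimately show "degree (raise t \<alpha> p) = Suc (degree p)" by simp
  with * show "lead_coeff (raise t \<alpha> p) = lead_coeff p" by simp
qed

lemma degree_herm: "degree (herm t M) = size M" "lead_coeff (herm t M) = 1"
proof -
  have "degree (herm t M) = size M \<and> lead_coeff (herm t M) = 1"
  proof (induction M)
    case (add \<alpha> M)
    then have "herm t M \<noteq> 0" by auto
    from degree_raise[OF this, of t \<alpha>] add show ?case by (auto simp: herm_add_mset)
  qed simp
  then show "degree (herm t M) = size M" "lead_coeff (herm t M) = 1" by auto
qed

text \<open>\<open>raise\<close> increases the degree by exactly one, so the leading term of a
  nonconstant \<open>d\<close> is matched by a raised monomial and the remainder has smaller degree.
  This is how an operator is peeled off in \<open>orthogonal_upto_degree\<close>.\<close>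

lemma raise_decompose:
  fixes d :: "'a::field poly"
  shows "\<exists>r e. d = [:r:] + raise t \<alpha> e"
proof (induction "degree d" arbitrary: d rule: less_induct)
  case less
  show ?case
  proof (cases "degree d")
    case 0
    then obtain r where "d = [:r:]" by (rule degree_eq_zeroE)
    then show ?thesis by (intro exI[of _ r] exI[of _ 0]) simp
  next
    case (Suc m)
    define c where "c = lead_coeff d"
    have "d \<noteq> 0" using Suc by auto
    then have c: "c \<noteq> 0" by (simp add: c_def)
    define g where "g = raise t \<alpha> (monom c m)"
    have g: "degree g = Suc m" "coeff g (Suc m) = c"
      using degree_raise[of "monom c m" t \<alpha>] c
      by (simp_all add: g_def degree_monom_eq monom_eq_0_iff)
    have "degree (d - g) < degree d"
    proof -
      have "degree (d - g) \<le> m"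
      proof (rule degree_le, intro allI impI)
        fix i assume "m < i"
        then consider "i = Suc m" | "i > Suc m" by linarith
        then show "coeff (d - g) i = 0"
          by cases (use g Suc c in \<open>simp_all add: c_def coeff_eq_0\<close>)
      qed
      then show ?thesis using Suc by simp
    qed
    from less[OF this] obtain r e where "d - g = [:r:] + raise t \<alpha> e" by blast
    then have "d = [:r:] + raise t \<alpha> (e + monom c m)"
      by (simp add: raise_add g_def algebra_simps)
    then show ?thesis by blast
  qed
qed

text \<open>Under \<open>x = \<sigma> y\<close> the derivative costs a factor
  \<open>1/\<sigma>\<close>, and another one appears when \<sigma> is pulled out of
  \<open>x - \<alpha>\<close>. With \<open>\<sigma> = sqrt n\<close> the value
  \<open>t = 1/2\<close> becomes \<open>1/(2n)\<close>.\<close>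

lemma pcompose_raise_scale:
  fixes \<sigma> :: "'a::field"
  assumes "\<sigma> \<noteq> 0"
  shows "pcompose (raise t \<alpha> p) [:0, \<sigma>:] = smult \<sigma> (raise (t / \<sigma>\<^sup>2) (\<alpha> / \<sigma>) (pcompose p [:0, \<sigma>:]))"
proof -
  have "smult t (pcompose (pderiv p) [:0, \<sigma>:]) =
      smult \<sigma> (smult (t / \<sigma>\<^sup>2) (pderiv (pcompose p [:0, \<sigma>:])))"
    using assms by (simp add: pderiv_pcompose pderiv_pCons power2_eq_square)
  moreover have "pcompose ([:- \<alpha>, 1:] * p) [:0, \<sigma>:] =
      smult \<sigma> ([:- (\<alpha> / \<sigma>), 1:] * pcompose p [:0, \<sigma>:])"
    by (simp only: pcompose_mult mult_smult_left[symmetric]) (use assms in \<open>simp add: pcompose_pCons\<close>)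
  ultimately show ?thesis
    unfolding raise_def pcompose_diff pcompose_smult smult_diff_right by simp
qed

lemma pcompose_herm_scale:
  fixes \<sigma> :: "'a::field"
  assumes "\<sigma> \<noteq> 0"
  shows "pcompose (herm t M) [:0, \<sigma>:] =
    smult (\<sigma> ^ size M) (herm (t / \<sigma>\<^sup>2) (image_mset (\<lambda>\<alpha>. \<alpha> / \<sigma>) M))"
proof (induction M)
  case empty
  show ?case by (simp add: one_pCons)
qed (simp add: herm_add_mset pcompose_raise_scale[OF assms] raise_smult)

section \<open>Reality and simplicity of the zeros\<close>

abbreviation cpoly :: "real poly \<Rightarrow> complex poly" where
  "cpoly \<equiv> map_poly complex_of_real"

lemma poly_cpoly: "poly (cpoly p) (of_real x) = of_real (poly p x)"
  by (induction p) (auto simp: map_poly_pCons)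

lemma cpoly_raise: "cpoly (raise t \<alpha> p) = raise (of_real t) (of_real \<alpha>) (cpoly p)"
  by (rule poly_eqI)
    (auto simp: raise_def coeff_map_poly coeff_pderiv coeff_pCons split: nat.splits)

lemma cpoly_herm: "cpoly (herm t M) = herm (of_real t) (image_mset of_real M)"
  by (induction M) (simp_all add: herm_add_mset cpoly_raise)

text \<open>Because \<open>R\<close> is a set, the product formula forces all zeros to be simple; it
  also makes \<open>p\<close> monic of degree \<open>m\<close>.\<close>

definition real_simple_rooted :: "nat \<Rightarrow> complex poly \<Rightarrow> real set \<Rightarrow> bool" where
  "real_simple_rooted m p R \<longleftrightarrow>
     finite R \<and> card R = m \<and> p = (\<Prod>r\<in>R. [:- complex_of_real r, 1:])"

text \<open>Let \<open>s\<close> and \<open>s2\<close> be the two sums. Then \<open>p' = p s\<close>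
  and \<open>s' = - s2\<close>, hence \<open>p'' = p (s\<^sup>2 - s2)\<close>. The induction over
  \<open>R\<close> avoids differentiating rational functions.\<close>

lemma log_deriv_prod_linear:
  fixes z :: "'a::field"
  assumes "finite R" "\<And>r. r \<in> R \<Longrightarrow> z \<noteq> r"
  shows "poly (pderiv (\<Prod>r\<in>R. [:- r, 1:])) z = poly (\<Prod>r\<in>R. [:- r, 1:]) z * (\<Sum>r\<in>R. 1 / (z - r))"
    "poly (pderiv (pderiv (\<Prod>r\<in>R. [:- r, 1:]))) z =
       poly (\<Prod>r\<in>R. [:- r, 1:]) z * ((\<Sum>r\<in>R. 1 / (z - r))\<^sup>2 - (\<Sum>r\<in>R. 1 / (z - r)\<^sup>2))"
proof -
  let ?P = "\<lambda>R. \<Prod>r\<in>R. [:- r, 1:]"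
  have "poly (pderiv (?P R)) z = poly (?P R) z * (\<Sum>r\<in>R. 1 / (z - r)) \<and>
    poly (pderiv (pderiv (?P R))) z =
       poly (?P R) z * ((\<Sum>r\<in>R. 1 / (z - r))\<^sup>2 - (\<Sum>r\<in>R. 1 / (z - r)\<^sup>2))"
    using assms
  proof (induction R rule: finite_induct)
    case (insert x F)
    define P where "P = ?P F"
    define s where "s = (\<Sum>r\<in>F. 1 / (z - r))"
    define s2 where "s2 = (\<Sum>r\<in>F. 1 / (z - r)\<^sup>2)"
    have IH: "poly (pderiv P) z = poly P z * s" "poly (pderiv (pderiv P)) z = poly P z * (s\<^sup>2 - s2)"
      using insert by (auto simp: P_def s_def s2_def)
    have nz: "z - x \<noteq> 0" using insert by auto
    have "poly (pderiv ([:-x, 1:] * P)) z = poly P z + (z - x) * (poly P z * s)"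
      by (simp only: pderiv_mult) (simp add: pderiv_pCons IH algebra_simps)
    moreover have "poly (pderiv (pderiv ([:-x, 1:] * P))) z =
        2 * (poly P z * s) + (z - x) * (poly P z * (s\<^sup>2 - s2))"
      by (simp only: pderiv_mult pderiv_add) (simp add: pderiv_pCons IH algebra_simps)
    moreover have "poly ([:-x, 1:] * P) z = (z - x) * poly P z"
      by (simp add: algebra_simps)
    moreover have "(z - x) * (1 / (z - x) + s) = 1 + (z - x) * s"
      "(z - x) * ((1 / (z - x) + s)\<^sup>2 - (1 / (z - x)\<^sup>2 + s2)) = 2 * s + (z - x) * (s\<^sup>2 - s2)"
    proof -
      define w where "w = z - x"
      have "w \<noteq> 0" using nz by (simp add: w_def)
      then show "(z - x) * (1 / (z - x) + s) = 1 + (z - x) * s"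
        "(z - x) * ((1 / (z - x) + s)\<^sup>2 - (1 / (z - x)\<^sup>2 + s2)) = 2 * s + (z - x) * (s\<^sup>2 - s2)"
        unfolding w_def[symmetric] by (simp_all add: divide_simps) (simp_all add: algebra_simps power2_eq_square)
    qed
    ultimately show ?case
      unfolding prod.insert[OF insert(1,2)] sum.insert[OF insert(1,2)] P_def[symmetric] s_def[symmetric] s2_def[symmetric]
      by (simp only: mult.assoc mult.left_commute[of _ "poly P z"]) (simp add: algebra_simps)
  qed simp
  then show "poly (pderiv (?P R)) z = poly (?P R) z * (\<Sum>r\<in>R. 1 / (z - r))"
    "poly (pderiv (pderiv (?P R))) z =
       poly (?P R) z * ((\<Sum>r\<in>R. 1 / (z - r))\<^sup>2 - (\<Sum>r\<in>R. 1 / (z - r)\<^sup>2))" by auto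
qed

lemma Im_inverse_diff_real: "Im (1 / (z - of_real r)) = - Im z / (cmod (z - of_real r))\<^sup>2"
  by (simp add: Im_divide cmod_power2)

text \<open>A zero of \<open>?q\<close> is not a zero of the squarefree \<open>p\<close>, so it
  solves \<open>z - \<alpha> - t s z = 0\<close>. The imaginary part of the left side is
  \<open>Im z\<close> times a positive number, so the zero is real. There
  \<open>?q' = p (1 + t s2)\<close> with \<open>s2\<close> nonnegative, so the zero is
  simple.\<close>

lemma real_simple_rooted_raise:
  assumes p: "real_simple_rooted m p R" and t: "t > 0"
  shows "\<exists>R'. real_simple_rooted (Suc m) (raise (of_real t) (of_real \<alpha>) p) R'"
proof -
  let ?q = "raise (of_real t) (of_real \<alpha>) p"
  have fR: "finite R" and cR: "card R = m" and pP: "p = (\<Prod>r\<in>R. [:- complex_of_real r, 1:])"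
    using p by (auto simp: real_simple_rooted_def)
  have inj: "inj_on complex_of_real R" by (auto intro: inj_onI)
  have pP': "p = (\<Prod>r\<in>of_real ` R. [:- r, 1:])"
    by (simp add: pP prod.reindex[OF inj])
  have pz: "poly p z = 0 \<longleftrightarrow> (\<exists>r\<in>R. z = of_real r)" for z
    using fR by (auto simp: pP poly_prod)
  have mon: "lead_coeff p = 1" unfolding pP lead_coeff_prod by simp
  have dp: "degree p = m"
    by (simp add: pP degree_prod_eq_sum_degree cR)
  have p0: "p \<noteq> 0" using mon by auto
  have q: "degree ?q = Suc m" "lead_coeff ?q = 1"
    using degree_raise[OF p0, of "of_real t" "of_real \<alpha>"] dp mon by auto
  define s where "s z = (\<Sum>r\<in>R. 1 / (z - complex_of_real r))" for z
  define s2 where "s2 z = (\<Sum>r\<in>R. 1 / (z - complex_of_real r)\<^sup>2)" for z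
  have d1: "poly (pderiv p) z = poly p z * s z" if "poly p z \<noteq> 0" for z
    using log_deriv_prod_linear(1)[of "of_real ` R" z] that fR
    by (auto simp: pz s_def sum.reindex[OF inj] simp flip: pP')
  have d2: "poly (pderiv (pderiv p)) z = poly p z * ((s z)\<^sup>2 - s2 z)" if "poly p z \<noteq> 0" for z
    using log_deriv_prod_linear(2)[of "of_real ` R" z] that fR
    by (auto simp: pz s_def s2_def sum.reindex[OF inj] simp flip: pP')
  have sqf: "rsquarefree p"
    unfolding rsquarefree_roots
  proof safe
    fix z assume "poly p z = 0" "poly (pderiv p) z = 0"
    then obtain r where r: "r \<in> R" "z = of_real r" by (auto simp: pz)
    have "p = [:- of_real r, 1:] * (\<Prod>r\<in>R - {r}. [:- complex_of_real r, 1:])"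
      using r fR by (simp add: pP prod.remove)
    then have "poly (pderiv p) z = poly (\<Prod>r\<in>R - {r}. [:- complex_of_real r, 1:]) z"
      by (simp only: pderiv_mult) (simp add: r pderiv_pCons)
    also have "\<dots> \<noteq> 0" using fR by (auto simp: poly_prod r)
    finally show False using \<open>poly (pderiv p) z = 0\<close> by simp
  qed
  have qz: "poly ?q z = (z - of_real \<alpha>) * poly p z - of_real t * poly (pderiv p) z" for z
    by (simp add: raise_def algebra_simps)
  have root: "poly p z \<noteq> 0" "z - of_real \<alpha> - of_real t * s z = 0" if "poly ?q z = 0" for z
  proof -
    \<comment> \<open>At a common zero of \<open>p\<close> and \<open>?q\<close> the derivative of
      \<open>p\<close> would vanish too, as \<open>t > 0\<close>.\<close>
    show *: "poly p z \<noteq> 0"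
      using that sqf t unfolding qz rsquarefree_roots by auto
    have "poly p z * (z - of_real \<alpha> - of_real t * s z) = 0"
      using that unfolding qz d1[OF *] by (simp add: algebra_simps)
    with * show "z - of_real \<alpha> - of_real t * s z = 0" by simp
  qed
  have realr: "Im z = 0" if "poly ?q z = 0" for z
  proof -
    have "Im (z - of_real \<alpha> - of_real t * s z) = Im z * (1 + t * (\<Sum>r\<in>R. 1 / (cmod (z - of_real r))\<^sup>2))"
      by (simp only: minus_complex.sel times_complex.sel Im_complex_of_real Re_complex_of_real
          s_def Im_sum Im_inverse_diff_real)
        (simp add: sum_negf sum_distrib_left algebra_simps)
    moreover have "1 + t * (\<Sum>r\<in>R. 1 / (cmod (z - of_real r))\<^sup>2) > 0"
      using t by (intro add_pos_nonneg mult_nonneg_nonneg sum_nonneg) auto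
    ultimately show ?thesis using root(2)[OF that] by simp
  qed
  have "rsquarefree ?q"
    unfolding rsquarefree_roots
  proof safe
    fix z assume a: "poly ?q z = 0" "poly (pderiv ?q) z = 0"
    note r = root[OF a(1)]
    obtain x where z: "z = of_real x" using realr[OF a(1)] by (metis complex_is_Real_iff Reals_cases)
    have "poly (pderiv ?q) z = poly p z + (z - of_real \<alpha>) * poly (pderiv p) z - of_real t * poly (pderiv (pderiv p)) z"
      by (simp add: pderiv_raise) (simp add: raise_def algebra_simps)
    also have "\<dots> = poly p z * (1 + of_real t * s2 z + (z - of_real \<alpha> - of_real t * s z) * s z)"
      unfolding d1[OF r(1)] d2[OF r(1)] by (simp add: algebra_simps power2_eq_square)
    finally have "1 + of_real t * s2 z = 0" using a r by simp
    moreover have "s2 z = of_real (\<Sum>r\<in>R. 1 / (x - r)\<^sup>2)"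
      by (simp add: s2_def z)
    ultimately have "of_real (1 + t * (\<Sum>r\<in>R. 1 / (x - r)\<^sup>2)) = (0 :: complex)" by simp
    then have "1 + t * (\<Sum>r\<in>R. 1 / (x - r)\<^sup>2) = 0" by (simp only: of_real_eq_0_iff)
    moreover have "1 + t * (\<Sum>r\<in>R. 1 / (x - r)\<^sup>2) > 0"
      using t by (intro add_pos_nonneg mult_nonneg_nonneg sum_nonneg) auto
    ultimately show False by simp
  qed
  \<comment> \<open>Over the complex numbers \<open>?q\<close> splits completely; its zeros being
    real, \<open>Re\<close> carries them injectively to \<open>R'\<close>.\<close>
  from complex_poly_decompose_rsquarefree[OF this]
  have dec: "?q = (\<Prod>z | poly ?q z = 0. [:- z, 1:])" using q by simp
  define R' where "R' = Re ` {z. poly ?q z = 0}"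
  have q0: "?q \<noteq> 0" using q by auto
  have fin: "finite {z. poly ?q z = 0}" by (rule poly_roots_finite[OF q0])
  have inj': "inj_on Re {z. poly ?q z = 0}" by (auto intro!: inj_onI complex_eqI simp: realr)
  have q': "?q = (\<Prod>r\<in>R'. [:- complex_of_real r, 1:])"
  proof -
    have "(\<Prod>r\<in>R'. [:- complex_of_real r, 1:]) = (\<Prod>z | poly ?q z = 0. [:- z, 1:])"
      unfolding R'_def prod.reindex[OF inj'] 
      by (intro prod.cong) (auto simp: complex_eq_iff realr)
    with dec show ?thesis by simp
  qed
  have "card R' = degree ?q"
    by (subst q') (simp add: degree_prod_eq_sum_degree)
  moreover have "finite R'" using fin by (simp add: R'_def)
  ultimately have "real_simple_rooted (Suc m) ?q R'"
    unfolding real_simple_rooted_def using q(1) q' by metis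
  then show ?thesis by blast
qed

lemma real_simple_rooted_herm:
  assumes "t > 0"
  shows "\<exists>R. real_simple_rooted (size M) (herm (of_real t) (image_mset of_real M)) R"
proof (induction M)
  case empty
  then show ?case by (intro exI[of _ "{}"]) (simp add: real_simple_rooted_def)
next
  case (add \<alpha> M)
  then show ?case using real_simple_rooted_raise[OF _ assms] by (auto simp: herm_add_mset)
qed

lemma herm_simple_real_roots:
  fixes M :: "real multiset"
  assumes "t > 0"
  defines "R \<equiv> {x. poly (herm t M) x = 0}"
  shows "finite R" "card R = size M" "cpoly (herm t M) = (\<Prod>r\<in>R. [:- complex_of_real r, 1:])"
proof -
  obtain R' where R': "real_simple_rooted (size M) (cpoly (herm t M)) R'"
    using real_simple_rooted_herm[OF assms(1), of M] by (auto simp: cpoly_herm)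
  have "poly (herm t M) x = 0 \<longleftrightarrow> x \<in> R'" for x
  proof -
    have "poly (herm t M) x = 0 \<longleftrightarrow> poly (cpoly (herm t M)) (of_real x) = 0"
      by (simp add: poly_cpoly)
    also have "\<dots> \<longleftrightarrow> x \<in> R'"
      using R' by (auto simp: real_simple_rooted_def poly_prod)
    finally show ?thesis .
  qed
  then have "R = R'" by (auto simp: R_def)
  with R' show "finite R" "card R = size M" "cpoly (herm t M) = (\<Prod>r\<in>R. [:- complex_of_real r, 1:])"
    by (auto simp: real_simple_rooted_def)
qed

section \<open>Orthogonality and uniqueness\<close>

text \<open>Completing the square turns the weight into a multiple of the normal density with mean
  \<gamma>/2 and variance 1/2; expanding \<open>p\<close> around the mean leaves normal
  moments.\<close>

lemma integrable_poly_hermite_weight: "integrable lborel (\<lambda>x. poly p x * hermite_weight \<gamma> x)"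
proof -
  define \<mu> where "\<mu> = \<gamma> / 2"
  define q where "q = pcompose p [:\<mu>, 1:]"
  have w: "hermite_weight \<gamma> x = exp (\<mu>\<^sup>2) * sqrt pi * normal_density \<mu> (1 / sqrt 2) x" for x
    by (simp add: hermite_weight_def normal_density_def \<mu>_def power_divide flip: exp_add)
      (simp add: power2_eq_square field_simps)
  have p: "poly p x = (\<Sum>i\<le>degree q. coeff q i * (x - \<mu>) ^ i)" for x
    unfolding poly_altdef[symmetric] by (simp add: q_def poly_pcompose)
  have "integrable lborel (\<lambda>x. \<Sum>i\<le>degree q. coeff q i * (exp (\<mu>\<^sup>2) * sqrt pi) *
      (normal_density \<mu> (1 / sqrt 2) x * (x - \<mu>) ^ i))"
    by (intro Bochner_Integration.integrable_sum Bochner_Integration.integrable_mult_right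
        integrable_normal_moment) simp
  then show ?thesis
    unfolding w p by (simp add: sum_distrib_right sum_distrib_left mult_ac)
qed

lemma tendsto_poly_hermite_weight:
  "((\<lambda>x. poly p x * hermite_weight \<gamma> x) \<longlongrightarrow> 0) at_top"
  "((\<lambda>x. poly p x * hermite_weight \<gamma> x) \<longlongrightarrow> 0) at_bot"
proof -
  have "((\<lambda>x. x ^ i * hermite_weight \<gamma> x) \<longlongrightarrow> 0) at_top" for i
    unfolding hermite_weight_def by real_asymp
  then have "((\<lambda>x. \<Sum>i\<le>degree p. coeff p i * (x ^ i * hermite_weight \<gamma> x)) \<longlongrightarrow> (\<Sum>i\<le>degree p. coeff p i * 0)) at_top"
    by (intro tendsto_intros)
  then show "((\<lambda>x. poly p x * hermite_weight \<gamma> x) \<longlongrightarrow> 0) at_top"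
    by (simp add: poly_altdef sum_distrib_right sum_distrib_left mult_ac)
  have "((\<lambda>x. x ^ i * hermite_weight \<gamma> x) \<longlongrightarrow> 0) at_bot" for i
    unfolding hermite_weight_def by real_asymp
  then have "((\<lambda>x. \<Sum>i\<le>degree p. coeff p i * (x ^ i * hermite_weight \<gamma> x)) \<longlongrightarrow> (\<Sum>i\<le>degree p. coeff p i * 0)) at_bot"
    by (intro tendsto_intros)
  then show "((\<lambda>x. poly p x * hermite_weight \<gamma> x) \<longlongrightarrow> 0) at_bot"
    by (simp add: poly_altdef sum_distrib_right sum_distrib_left mult_ac)
qed

section \<open>Gaussian moment functionals and integration by parts\<close>

definition gauss_functional :: "real \<Rightarrow> real poly \<Rightarrow> real" where
  "gauss_functional \<gamma> p = (\<integral>x. poly p x * hermite_weight \<gamma> x \<partial>lborel)"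

lemma gauss_functional_add: "gauss_functional \<gamma> (p + q) = gauss_functional \<gamma> p + gauss_functional \<gamma> q"
  by (simp add: gauss_functional_def distrib_right integrable_poly_hermite_weight)

lemma gauss_functional_diff: "gauss_functional \<gamma> (p - q) = gauss_functional \<gamma> p - gauss_functional \<gamma> q"
  by (simp add: gauss_functional_def left_diff_distrib integrable_poly_hermite_weight)

lemma gauss_functional_smult: "gauss_functional \<gamma> (smult c p) = c * gauss_functional \<gamma> p"
  by (simp add: gauss_functional_def mult.assoc)

text \<open>The derivative of \<open>p\<close> times the weight is
  \<open>p' - (2x - \<gamma>) p\<close> times the weight, and the boundary terms vanish at both
  infinities.\<close>

lemma gauss_functional_pderiv: "gauss_functional \<gamma> (pderiv p) = gauss_functional \<gamma> ([:- \<gamma>, 2:] * p)"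
proof -
  let ?F = "\<lambda>x. poly p x * hermite_weight \<gamma> x"
  let ?f = "\<lambda>x. poly (pderiv p - [:- \<gamma>, 2:] * p) x * hermite_weight \<gamma> x"
  have d: "(?F has_real_derivative ?f x) (at x)" for x
    unfolding hermite_weight_def
    by (auto intro!: derivative_eq_intros simp: algebra_simps)
  have "(LBINT x=-\<infinity>..\<infinity>. ?f x) = 0 - 0"
  proof (rule interval_integral_FTC_integrable)
    show "((?F \<circ> real_of_ereal) \<longlongrightarrow> 0) (at_right (-\<infinity>))"
      using tendsto_poly_hermite_weight(2) by (simp add: ereal_tendsto_simps)
    show "((?F \<circ> real_of_ereal) \<longlongrightarrow> 0) (at_left \<infinity>)"
      using tendsto_poly_hermite_weight(1) by (simp add: ereal_tendsto_simps)
    show "isCont ?f x" for x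
      unfolding hermite_weight_def by (intro continuous_intros)
    show "set_integrable lborel (einterval (- \<infinity>) \<infinity>) ?f"
      using integrable_poly_hermite_weight[of "pderiv p - [:- \<gamma>, 2:] * p" \<gamma>]
      by (simp add: set_integrable_def)
  qed (use d in \<open>auto simp: has_real_derivative_iff_has_vector_derivative\<close>)
  then have "gauss_functional \<gamma> (pderiv p - [:- \<gamma>, 2:] * p) = 0"
    by (simp add: interval_lebesgue_integral_def set_lebesgue_integral_def gauss_functional_def)
  then show ?thesis by (simp add: gauss_functional_diff)
qed

text \<open>Integration by parts gives the adjoint of \<open>raise\<close>, namely
  \<open>q \<mapsto> (\<gamma>/2 - \<alpha>) q + q'/2\<close>. For \<gamma> = 2\<alpha> only the
  derivative is left, so testing against \<open>q\<close> becomes testing against a polynomial of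
  lower degree.\<close>

lemma gauss_functional_raise:
  "gauss_functional \<gamma> (q * raise (1 / 2) \<alpha> p) =
    gauss_functional \<gamma> ((smult (\<gamma> / 2 - \<alpha>) q + smult (1 / 2) (pderiv q)) * p)"
proof -
  have "gauss_functional \<gamma> (smult (1 / 2) (pderiv (q * p))) = gauss_functional \<gamma> (smult (1 / 2) ([:- \<gamma>, 2:] * (q * p)))"
    by (simp only: gauss_functional_smult gauss_functional_pderiv)
  moreover have "q * raise (1 / 2) \<alpha> p =
      ((smult (\<gamma> / 2 - \<alpha>) q + smult (1 / 2) (pderiv q)) * p + smult (1 / 2) ([:- \<gamma>, 2:] * (q * p))) - smult (1 / 2) (pderiv (q * p))"
    by (rule poly_ext) (simp add: raise_def pderiv_mult field_simps)
  ultimately show ?thesis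
    by (simp only: gauss_functional_add gauss_functional_diff)
qed

text \<open>The weight is positive, so \<open>p\<close> vanishes almost everywhere, whereas a
  nonzero polynomial has a finite, hence null, set of zeros.\<close>

lemma gauss_functional_square_eq_0:
  assumes "gauss_functional \<gamma> (p * p) = 0"
  shows "p = 0"
proof -
  have "AE x in lborel. poly (p * p) x * hermite_weight \<gamma> x = 0"
    using assms integrable_poly_hermite_weight[of "p * p" \<gamma>]
    by (subst integral_nonneg_eq_0_iff_AE[symmetric])
      (auto simp: gauss_functional_def hermite_weight_def)
  then have "AE x in lborel. x \<in> {x. poly p x = 0}"
    by (auto simp: hermite_weight_def)
  show ?thesis
  proof (rule ccontr)
    assume "p \<noteq> 0"
    then have "finite {x. poly p x = 0}" by (rule poly_roots_finite)
    then have "AE x in lborel. x \<notin> {x. poly p x = 0}"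
      by (intro AE_not_in finite_imp_null_set_lborel)
    with \<open>AE x in lborel. x \<in> {x. poly p x = 0}\<close>
    have "AE x in (lborel :: real measure). False" by eventually_elim auto
    then show False
      by (auto simp: eventually_ae_filter null_sets_def top.extremum_unique)
  qed
qed

text \<open>The point \<open>\<alpha>\<close> corresponds to the weight \<open>exp (- x\<^sup>2 + 2 \<alpha> x)\<close>, hence the parameter \<open>2 \<alpha>\<close>.\<close>

definition orthogonal_upto :: "real multiset \<Rightarrow> real poly \<Rightarrow> bool" where
  "orthogonal_upto M p \<longleftrightarrow> (\<forall>\<alpha> k. k < count M \<alpha> \<longrightarrow> gauss_functional (2 * \<alpha>) (monom 1 k * p) = 0)"

text \<open>The adjoint formula for \<open>q = x^k\<close>. At \<open>k = 0\<close> the truncated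
  \<open>k - 1\<close> is harmless because its coefficient is zero.\<close>

lemma gauss_functional_monom_raise:
  "gauss_functional \<gamma> (monom 1 k * raise (1 / 2) \<alpha> p) =
    (\<gamma> / 2 - \<alpha>) * gauss_functional \<gamma> (monom 1 k * p) + k / 2 * gauss_functional \<gamma> (monom 1 (k - 1) * p)"
proof -
  have "(smult (\<gamma> / 2 - \<alpha>) (monom 1 k) + smult (1 / 2) (pderiv (monom 1 k))) * p =
      smult (\<gamma> / 2 - \<alpha>) (monom 1 k * p) + smult (k / 2) (monom 1 (k - 1) * p)"
    by (rule poly_ext) (simp add: pderiv_monom poly_monom algebra_simps)
  then show ?thesis
    by (simp only: gauss_functional_raise gauss_functional_add gauss_functional_smult)
qed

text \<open>For \<beta> = \<alpha> the moment formula loses its first term, so the moment of order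
  \<open>k + 1\<close> after raising is a nonzero multiple of the moment of order \<open>k\<close>
  before: exactly one order is gained. For other \<beta> the first coefficient is nonzero, and
  induction on \<open>k\<close> shows that the vanishing moments are the same.\<close>

lemma orthogonal_upto_raise_iff:
  "orthogonal_upto (add_mset \<alpha> M) (raise (1 / 2) \<alpha> p) \<longleftrightarrow> orthogonal_upto M p"
proof
  assume p: "orthogonal_upto M p"
  show "orthogonal_upto (add_mset \<alpha> M) (raise (1 / 2) \<alpha> p)"
    unfolding orthogonal_upto_def
  proof (intro allI impI)
    fix \<beta> k assume k: "k < count (add_mset \<alpha> M) \<beta>"
    have "real k * gauss_functional (2 * \<beta>) (monom 1 (k - 1) * p) = 0"
      using p k unfolding orthogonal_upto_def by (cases k) (auto split: if_splits)
    moreover have "(\<beta> - \<alpha>) * gauss_functional (2 * \<beta>) (monom 1 k * p) = 0"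
      using p k unfolding orthogonal_upto_def by (auto split: if_splits)
    ultimately show "gauss_functional (2 * \<beta>) (monom 1 k * raise (1 / 2) \<alpha> p) = 0"
      unfolding gauss_functional_monom_raise by auto
  qed
next
  assume q: "orthogonal_upto (add_mset \<alpha> M) (raise (1 / 2) \<alpha> p)"
  have "gauss_functional (2 * \<beta>) (monom 1 k * p) = 0" if "k < count M \<beta>" for \<beta> k
    using that
  proof (induction k rule: less_induct)
    case (less k)
    show ?case
    proof (cases "\<beta> = \<alpha>")
      case True
      then have "gauss_functional (2 * \<beta>) (monom 1 (Suc k) * raise (1 / 2) \<alpha> p) = 0"
        using q less.prems unfolding orthogonal_upto_def by auto
      then show ?thesis unfolding gauss_functional_monom_raise using True by simp
    next
      case False
      then have "gauss_functional (2 * \<beta>) (monom 1 k * raise (1 / 2) \<alpha> p) = 0"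
        using q less.prems unfolding orthogonal_upto_def by auto
      moreover have "real k * gauss_functional (2 * \<beta>) (monom 1 (k - 1) * p) = 0"
        using less by (cases k) auto
      ultimately show ?thesis unfolding gauss_functional_monom_raise using False by auto
    qed
  qed
  then show "orthogonal_upto M p" by (auto simp: orthogonal_upto_def)
qed

lemma orthogonal_upto_herm: "orthogonal_upto M (herm (1 / 2) M)"
  by (induction M) (auto simp: herm_add_mset orthogonal_upto_raise_iff, simp add: orthogonal_upto_def)

text \<open>Each condition costs one degree: the zeroth moment at \<alpha> kills the constant part
  of \<open>d\<close>, so \<open>d\<close> is a raised polynomial \<open>e\<close> of degree one
  less, and \<open>e\<close> satisfies the remaining conditions.\<close>

lemma orthogonal_upto_degree:
  assumes "orthogonal_upto M d" "d \<noteq> 0"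
  shows "size M \<le> degree d"
  using assms
proof (induction M arbitrary: d)
  case (add \<alpha> M)
  obtain r e where d: "d = [:r:] + raise (1 / 2) \<alpha> e"
    using raise_decompose by blast
  \<comment> \<open>Here \<gamma> = 2\<alpha> and \<open>k = 0\<close>, so both coefficients in the
    moment formula vanish.\<close>
  have "gauss_functional (2 * \<alpha>) (monom 1 0 * raise (1 / 2) \<alpha> e) = 0"
    unfolding gauss_functional_monom_raise by simp
  moreover have "gauss_functional (2 * \<alpha>) (monom 1 0 * d) = 0"
    using add.prems(1)[unfolded orthogonal_upto_def, rule_format, of 0 \<alpha>] by simp
  ultimately have "gauss_functional (2 * \<alpha>) [:r:] = 0"
    by (simp add: d gauss_functional_add monom_0 one_pCons[symmetric])
  \<comment> \<open>Multiplying by \<open>r\<close> produces a square, to which positivity of the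
    weight applies.\<close>
  then have "gauss_functional (2 * \<alpha>) ([:r:] * [:r:]) = 0"
    using gauss_functional_smult[of "2 * \<alpha>" r "[:r:]"] by simp
  then have "[:r:] = 0" by (rule gauss_functional_square_eq_0)
  with d have d: "d = raise (1 / 2) \<alpha> e" by simp
  with add.prems have "e \<noteq> 0" "orthogonal_upto M e" by (auto simp: orthogonal_upto_raise_iff)
  with add.IH d degree_raise[of e "1/2" \<alpha>] show ?case by auto
qed simp

section \<open>Identification of the multiple Hermite polynomial\<close>

definition hermite_points :: "nat \<Rightarrow> real set \<Rightarrow> real multiset" where
  "hermite_points n A = repeat_mset n (mset_set A)"

lemma is_multiple_hermite_iff:
  assumes "c > 0"
  shows "is_multiple_hermite n c p \<longleftrightarrow> degree p = 3 * n \<and> lead_coeff p = 1 \<and>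
    orthogonal_upto (hermite_points n {- c / 2, 0, c / 2}) p"
proof -
  have i: "integrable lborel (\<lambda>x. x ^ k * poly p x * hermite_weight \<gamma> x)" for k \<gamma>
    using integrable_poly_hermite_weight[of "monom 1 k * p" \<gamma>] by (simp add: poly_monom)
  have g: "(\<integral>x. x ^ k * poly p x * hermite_weight \<gamma> x \<partial>lborel) = gauss_functional \<gamma> (monom 1 k * p)" for k \<gamma>
    by (simp add: gauss_functional_def poly_monom)
  have "(\<forall>\<gamma>\<in>{- c, 0, c}. \<forall>k<n. gauss_functional \<gamma> (monom 1 k * p) = 0) \<longleftrightarrow>
      orthogonal_upto (hermite_points n {- c / 2, 0, c / 2}) p"
    using assms by (auto simp: orthogonal_upto_def hermite_points_def count_mset_set' mult.commute[of _ 2]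
        dest: spec[of _ "c / 2"])
  with i g show ?thesis by (simp add: is_multiple_hermite_def)
qed

text \<open>For uniqueness, the difference of two solutions satisfies \<open>3 n\<close>
  orthogonality conditions, so it is zero or has degree at least \<open>3 n\<close>; but its
  coefficient of that order cancels, both being monic.\<close>

lemma multiple_hermite_eq:
  assumes "c > 0"
  shows "multiple_hermite n c = herm (1 / 2) (hermite_points n {- c / 2, 0, c / 2})"
proof -
  let ?M = "hermite_points n {- c / 2, 0, c / 2}"
  let ?H = "herm (1 / 2) ?M"
  have sz: "size ?M = 3 * n"
    using assms by (simp add: hermite_points_def)
  show ?thesis
    unfolding multiple_hermite_def
  proof (rule the_equality)
    show "is_multiple_hermite n c ?H"
      using sz by (simp add: is_multiple_hermite_iff[OF assms] degree_herm orthogonal_upto_herm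
          del: One_nat_def) (use degree_herm(2)[of "1/2" ?M] degree_herm(1)[of "1/2" ?M] in simp)
  next
    fix p assume p: "is_multiple_hermite n c p"
    have o: "orthogonal_upto ?M (p - ?H)"
      using p orthogonal_upto_herm[of ?M]
      by (auto simp: is_multiple_hermite_iff[OF assms] orthogonal_upto_def right_diff_distrib gauss_functional_diff)
    have H: "degree ?H = 3 * n" "coeff ?H (3 * n) = 1"
      using degree_herm[of "1/2" ?M] sz by auto
    have P: "degree p = 3 * n" "coeff p (3 * n) = 1"
      using p by (auto simp: is_multiple_hermite_def)
    show "p = ?H"
    proof (rule ccontr)
      assume ne: "p \<noteq> ?H"
      then have "degree (p - ?H) \<ge> 3 * n" using orthogonal_upto_degree[OF o] sz by simp
      moreover have "degree (p - ?H) \<le> 3 * n" using H P degree_diff_le[of p "3 * n" ?H] by simp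
      ultimately have "degree (p - ?H) = 3 * n" by simp
      moreover have "coeff (p - ?H) (3 * n) = 0" using H P by simp
      ultimately have "p - ?H = 0" by (metis leading_coeff_0_iff)
      with ne show False by simp
    qed
  qed
qed

section \<open>The subordination map\<close>

text \<open>The convergence argument works for any finite set of sources; the three-point set
  returns with the support analysis.\<close>

locale sources =
  fixes A :: "real set"
  assumes finite_A: "finite A"
begin

text \<open>The map \<psi> of the overview. With \<open>G\<close> the Stieltjes transform of the
  uniform measure on a nonempty \<open>A\<close> it is \<open>w + (card A / 2) G(w)\<close>, the
  inverse subordination map for free convolution with a semicircle of variance
  \<open>card A / 2\<close>.\<close>

definition subord :: "complex \<Rightarrow> complex" where
  "subord w = w + (\<Sum>\<alpha>\<in>A. 1 / (w - of_real \<alpha>)) / 2"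

definition spread :: "complex \<Rightarrow> real" where
  "spread w = (\<Sum>\<alpha>\<in>A. 1 / (cmod (w - of_real \<alpha>))\<^sup>2) / 2"

text \<open>The closed region on which \<open>subord\<close> takes values in the closed upper
  half-plane. Sources are excluded explicitly: division by zero gives 0, so \<open>spread\<close>
  would not detect the pole there.\<close>

definition subord_dom :: "complex set" where
  "subord_dom = {w. 0 \<le> Im w \<and> w \<notin> of_real ` A \<and> spread w \<le> 1}"

lemma Im_subord: "Im (subord w) = Im w * (1 - spread w)"
proof -
  have "Im (\<Sum>\<alpha>\<in>A. 1 / (w - of_real \<alpha>)) = - Im w * (\<Sum>\<alpha>\<in>A. 1 / (cmod (w - of_real \<alpha>))\<^sup>2)"
    by (simp only: Im_sum Im_inverse_diff_real) (simp add: sum_distrib_left sum_negf)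
  then show ?thesis
    by (simp add: subord_def spread_def algebra_simps)
qed

lemma subord_diff:
  assumes "w1 \<notin> of_real ` A" "w2 \<notin> of_real ` A"
  shows "subord w1 - subord w2 =
    (w1 - w2) * (1 - (\<Sum>\<alpha>\<in>A. 1 / ((w1 - of_real \<alpha>) * (w2 - of_real \<alpha>))) / 2)"
proof -
  have "(\<Sum>\<alpha>\<in>A. 1 / (w1 - of_real \<alpha>)) - (\<Sum>\<alpha>\<in>A. 1 / (w2 - of_real \<alpha>)) =
      (\<Sum>\<alpha>\<in>A. (w2 - w1) * (1 / ((w1 - of_real \<alpha>) * (w2 - of_real \<alpha>))))"
    unfolding sum_subtractf[symmetric]
  proof (rule sum.cong)
    fix \<alpha> assume "\<alpha> \<in> A"
    then have "w1 - of_real \<alpha> \<noteq> 0" "w2 - of_real \<alpha> \<noteq> 0" using assms by auto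
    then show "1 / (w1 - of_real \<alpha>) - 1 / (w2 - of_real \<alpha>) = (w2 - w1) * (1 / ((w1 - of_real \<alpha>) * (w2 - of_real \<alpha>)))"
      by (simp add: field_simps)
  qed simp
  also have "\<dots> = (w2 - w1) * (\<Sum>\<alpha>\<in>A. 1 / ((w1 - of_real \<alpha>) * (w2 - of_real \<alpha>)))"
    by (simp only: sum_distrib_left)
  finally have *: "(\<Sum>\<alpha>\<in>A. 1 / (w1 - of_real \<alpha>)) - (\<Sum>\<alpha>\<in>A. 1 / (w2 - of_real \<alpha>)) =
      (w2 - w1) * (\<Sum>\<alpha>\<in>A. 1 / ((w1 - of_real \<alpha>) * (w2 - of_real \<alpha>)))" .
  have "subord w1 - subord w2 =
      (w1 - w2) + ((\<Sum>\<alpha>\<in>A. 1 / (w1 - of_real \<alpha>)) - (\<Sum>\<alpha>\<in>A. 1 / (w2 - of_real \<alpha>))) / 2"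
    by (simp add: subord_def diff_divide_distrib)
  then show ?thesis unfolding * by (simp add: right_diff_distrib left_diff_distrib diff_divide_distrib)
qed

text \<open>Expand \<open>|x - cnj y|\<^sup>2 = |x|\<^sup>2 + |y|\<^sup>2 - 2 Re (x y)\<close> with
  \<open>x = 1/(w1 - \<alpha>)\<close> and \<open>y = 1/(w2 - \<alpha>)\<close>, sum over \<alpha>,
  and bound both spreads by 1. This is Cauchy-Schwarz with its defect kept.\<close>

lemma subord_dom_cross_bound:
  assumes "w1 \<in> subord_dom" "w2 \<in> subord_dom"
  shows "(\<Sum>\<alpha>\<in>A. (cmod (1 / (w1 - of_real \<alpha>) - cnj (1 / (w2 - of_real \<alpha>))))\<^sup>2) \<le>
    4 * (1 - Re ((\<Sum>\<alpha>\<in>A. 1 / ((w1 - of_real \<alpha>) * (w2 - of_real \<alpha>))) / 2))"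
proof -
  have *: "(cmod (x - cnj y))\<^sup>2 = (cmod x)\<^sup>2 + (cmod y)\<^sup>2 - 2 * Re (x * y)" for x y
    unfolding cmod_power2 by (simp add: power2_eq_square algebra_simps)
  have "(\<Sum>\<alpha>\<in>A. (cmod (1 / (w1 - of_real \<alpha>) - cnj (1 / (w2 - of_real \<alpha>))))\<^sup>2) =
      2 * spread w1 + 2 * spread w2 - 2 * Re (\<Sum>\<alpha>\<in>A. 1 / ((w1 - of_real \<alpha>) * (w2 - of_real \<alpha>)))"
    unfolding * by (simp add: spread_def norm_divide power_divide sum.distrib sum_subtractf flip: sum_distrib_left)
  with assms show ?thesis by (simp add: subord_dom_def)
qed

text \<open>For distinct points with equal image the second factor in \<open>subord_diff\<close>
  vanishes, so the defect is zero and \<open>w1 = cnj w2\<close>. Both points lie in the closed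
  upper half-plane, hence they are real and equal.\<close>

lemma subord_inj: "inj_on subord subord_dom"
proof (rule inj_onI, rule ccontr)
  fix w1 w2 assume w: "w1 \<in> subord_dom" "w2 \<in> subord_dom" and eq: "subord w1 = subord w2" and ne: "w1 \<noteq> w2"
  have "1 - (\<Sum>\<alpha>\<in>A. 1 / ((w1 - of_real \<alpha>) * (w2 - of_real \<alpha>))) / 2 = 0"
    using subord_diff[of w1 w2] w eq ne by (simp add: subord_dom_def)
  then have one: "(\<Sum>\<alpha>\<in>A. 1 / ((w1 - of_real \<alpha>) * (w2 - of_real \<alpha>))) / 2 = 1" by simp
  with subord_dom_cross_bound[OF w]
  have le: "(\<Sum>\<alpha>\<in>A. (cmod (1 / (w1 - of_real \<alpha>) - cnj (1 / (w2 - of_real \<alpha>))))\<^sup>2) \<le> 0"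
    by simp
  have "A \<noteq> {}" using one by auto
  then obtain \<alpha> where \<alpha>: "\<alpha> \<in> A" by auto
  have "(cmod (1 / (w1 - of_real \<alpha>) - cnj (1 / (w2 - of_real \<alpha>))))\<^sup>2 \<le>
      (\<Sum>\<alpha>\<in>A. (cmod (1 / (w1 - of_real \<alpha>) - cnj (1 / (w2 - of_real \<alpha>))))\<^sup>2)"
    by (rule member_le_sum[OF \<alpha>]) (auto simp: finite_A)
  with le have "(cmod (1 / (w1 - of_real \<alpha>) - cnj (1 / (w2 - of_real \<alpha>))))\<^sup>2 \<le> 0" by linarith
  then have "1 / (w1 - of_real \<alpha>) = cnj (1 / (w2 - of_real \<alpha>))" by simp
  then have "w1 - of_real \<alpha> = cnj (w2 - of_real \<alpha>)" by (simp add: divide_inverse)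
  then have "w1 = cnj w2" by simp
  moreover from this have "Im w1 = 0" "Im w2 = 0" using w by (auto simp: subord_dom_def)
  ultimately show False using ne by (auto simp: complex_eq_iff)
qed

section \<open>Properness of the subordination map\<close>

lemma subord_dom_dist:
  assumes "w \<in> subord_dom" "\<alpha> \<in> A"
  shows "1 / 2 \<le> (cmod (w - of_real \<alpha>))\<^sup>2"
proof -
  have "1 / (cmod (w - of_real \<alpha>))\<^sup>2 \<le> (\<Sum>\<alpha>\<in>A. 1 / (cmod (w - of_real \<alpha>))\<^sup>2)"
    by (rule member_le_sum[OF assms(2)]) (auto simp: finite_A)
  also have "\<dots> \<le> 2" using assms by (simp add: subord_dom_def spread_def)
  finally have "1 / (cmod (w - of_real \<alpha>))\<^sup>2 \<le> 2" .
  moreover have "cmod (w - of_real \<alpha>) > 0" using assms by (auto simp: subord_dom_def)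
  ultimately show ?thesis by (simp add: field_simps)
qed

text \<open>\<open>spread\<close> is not continuous at the sources. On the closed set
  \<open>?T\<close>, which stays away from them, it is, and the domain is a sublevel set inside
  \<open>?T\<close>.\<close>

lemma closed_subord_dom: "closed subord_dom"
proof -
  let ?T = "{w. 0 \<le> Im w} \<inter> (\<Inter>\<alpha>\<in>A. {w. 1 / 2 \<le> (cmod (w - of_real \<alpha>))\<^sup>2})"
  have T: "closed ?T"
    by (intro closed_Int closed_INT ballI closed_Collect_le continuous_intros)
  have T': "w \<noteq> of_real \<alpha>" if "w \<in> ?T" "\<alpha> \<in> A" for w \<alpha>
  proof -
    have "1 / 2 \<le> (cmod (w - of_real \<alpha>))\<^sup>2" using that by blast
    then show ?thesis by auto
  qed
  have "continuous_on ?T spread"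
    unfolding spread_def
    by (intro continuous_intros ballI; (drule (1) T')?) auto
  then have "closed {w \<in> ?T. spread w \<le> 1}"
    by (intro continuous_on_closed_Collect_le T continuous_intros)
  also have "{w \<in> ?T. spread w \<le> 1} = subord_dom"
  proof (intro equalityI subsetI)
    fix w assume "w \<in> subord_dom"
    then show "w \<in> {w \<in> ?T. spread w \<le> 1}"
      using subord_dom_dist[of w] unfolding subord_dom_def by blast
  next
    fix w assume "w \<in> {w \<in> ?T. spread w \<le> 1}"
    then show "w \<in> subord_dom" using T'[of w] unfolding subord_dom_def by blast
  qed
  finally show ?thesis .
qed

lemma continuous_on_subord: "continuous_on subord_dom subord"
  unfolding subord_def by (intro continuous_intros) (auto simp: subord_dom_def)

lemma subord_near:
  assumes "w \<in> subord_dom"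
  shows "cmod (subord w - w) \<le> card A"
proof -
  have "cmod (\<Sum>\<alpha>\<in>A. 1 / (w - of_real \<alpha>)) \<le> (\<Sum>\<alpha>\<in>A. cmod (1 / (w - of_real \<alpha>)))"
    by (rule norm_sum)
  also have "\<dots> \<le> (\<Sum>\<alpha>\<in>A. 2)"
  proof (rule sum_mono)
    fix \<alpha> assume "\<alpha> \<in> A"
    have "cmod (w - of_real \<alpha>) \<ge> 1 / 2"
    proof (rule ccontr)
      assume "\<not> ?thesis"
      then have "(cmod (w - of_real \<alpha>))\<^sup>2 \<le> (1 / 2)\<^sup>2" by (intro power_mono) auto
      with subord_dom_dist[OF assms \<open>\<alpha> \<in> A\<close>] show False by (simp add: power2_eq_square)
    qed
    then have "1 / cmod (w - of_real \<alpha>) \<le> 1 / (1 / 2)"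
      by (intro divide_left_mono) auto
    then show "cmod (1 / (w - of_real \<alpha>)) \<le> 2" by (simp add: norm_divide)
  qed
  finally show ?thesis by (simp add: subord_def norm_divide)
qed

text \<open>Convergent images are bounded, and \<open>subord\<close> moves points by at most
  \<open>card A\<close>, so the \<open>w n\<close> stay in a compact part of the domain. There the
  continuous injective \<open>subord\<close> has a continuous inverse.\<close>

lemma subord_proper:
  assumes w: "\<And>n. w n \<in> subord_dom" and z: "(\<lambda>n. subord (w n)) \<longlonglongrightarrow> z"
  shows "\<exists>l\<in>subord_dom. subord l = z \<and> w \<longlonglongrightarrow> l"
proof -
  from convergent_imp_Bseq[OF convergentI[OF z]] obtain B where B: "\<And>n. cmod (subord (w n)) \<le> B"
    by (auto simp: Bseq_def)
  define C where "C = subord_dom \<inter> cball 0 (B + card A)"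
  have wC: "w n \<in> C" for n
  proof -
    have "cmod (w n) \<le> cmod (subord (w n)) + cmod (subord (w n) - w n)"
      by (metis norm_triangle_sub add.commute norm_minus_commute)
    then show ?thesis using B[of n] subord_near[OF w[of n]] w by (simp add: C_def)
  qed
  have C: "compact C" unfolding C_def by (rule closed_Int_compact[OF closed_subord_dom compact_cball])
  have cont: "continuous_on C subord"
    by (rule continuous_on_subset[OF continuous_on_subord]) (auto simp: C_def)
  have inj: "inj_on subord C"
    by (rule inj_on_subset[OF subord_inj]) (auto simp: C_def)
  have "closed (subord ` C)" by (intro compact_imp_closed compact_continuous_image cont C)
  then have "z \<in> subord ` C"
    by (rule closed_sequentially[OF _ _ z]) (use wC in auto)
  then obtain l where l: "l \<in> C" "z = subord l" by auto
  define g where "g = inv_into C subord"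
  have g: "g (subord x) = x" if "x \<in> C" for x
    using inj that by (simp add: g_def)
  have "continuous_on (subord ` C) g"
    by (rule continuous_on_inv[OF cont C]) (use g in auto)
  then have "(\<lambda>n. g (subord (w n))) \<longlonglongrightarrow> g z"
    by (rule continuous_on_tendsto_compose[OF _ z]) (use wC l in auto)
  then have "w \<longlonglongrightarrow> l" using g wC l by simp
  with l show ?thesis by (auto simp: C_def)
qed

end

section \<open>Convergence of the logarithmic derivatives\<close>

definition log_deriv :: "real set \<Rightarrow> complex \<Rightarrow> complex" where
  "log_deriv R z = (\<Sum>r\<in>R. 1 / (z - of_real r))"

definition herm_roots :: "real \<Rightarrow> real multiset \<Rightarrow> real set" where
  "herm_roots t M = {x. poly (herm t M) x = 0}"

lemma Im_log_deriv_nonpos: "Im z > 0 \<Longrightarrow> Im (log_deriv R z) \<le> 0"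
  unfolding log_deriv_def Im_sum Im_inverse_diff_real by (intro sum_nonpos) auto

lemma norm_sum_inverse_power_le:
  assumes "Im z > 0"
  shows "cmod (\<Sum>r\<in>R. 1 / (z - of_real r) ^ k) \<le> card R / Im z ^ k"
proof -
  have "cmod (\<Sum>r\<in>R. 1 / (z - of_real r) ^ k) \<le> (\<Sum>r\<in>R. 1 / Im z ^ k)"
  proof (rule sum_norm_le)
    fix r
    have "Im z \<le> cmod (z - of_real r)" using abs_Im_le_cmod[of "z - of_real r"] by simp
    then show "cmod (1 / (z - of_real r) ^ k) \<le> 1 / Im z ^ k"
      using assms by (auto simp: norm_divide norm_power intro!: divide_left_mono power_mono mult_pos_pos zero_less_power)
  qed
  then show ?thesis by simp
qed

lemma herm_log_deriv:
  assumes "t > 0" "Im z > 0"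
  shows "poly (cpoly (herm t M)) z \<noteq> 0"
    "poly (pderiv (cpoly (herm t M))) z = poly (cpoly (herm t M)) z * log_deriv (herm_roots t M) z"
    "poly (pderiv (pderiv (cpoly (herm t M)))) z = poly (cpoly (herm t M)) z *
      ((log_deriv (herm_roots t M) z)\<^sup>2 - (\<Sum>r\<in>herm_roots t M. 1 / (z - of_real r)\<^sup>2))"
proof -
  let ?R = "herm_roots t M"
  have R: "finite ?R" "cpoly (herm t M) = (\<Prod>r\<in>?R. [:- complex_of_real r, 1:])"
    using herm_simple_real_roots[OF assms(1), of M] by (auto simp: herm_roots_def)
  have inj: "inj_on complex_of_real ?R" by (auto intro: inj_onI)
  have R': "cpoly (herm t M) = (\<Prod>r\<in>of_real ` ?R. [:- r, 1:])"
    unfolding R(2) by (simp add: prod.reindex[OF inj])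
  have nz: "z \<noteq> of_real r" for r using assms(2) by auto
  show "poly (cpoly (herm t M)) z \<noteq> 0"
    using nz R(1) by (simp add: R(2) poly_prod)
  have "finite (complex_of_real ` ?R)" using R(1) by simp
  note L = log_deriv_prod_linear[OF this, of z, folded R', unfolded sum.reindex[OF inj] comp_def]
  show "poly (pderiv (cpoly (herm t M))) z = poly (cpoly (herm t M)) z * log_deriv (herm_roots t M) z"
    unfolding log_deriv_def using nz by (intro L(1)) auto
  show "poly (pderiv (pderiv (cpoly (herm t M)))) z = poly (cpoly (herm t M)) z *
      ((log_deriv (herm_roots t M) z)\<^sup>2 - (\<Sum>r\<in>herm_roots t M. 1 / (z - of_real r)\<^sup>2))"
    unfolding log_deriv_def using nz by (intro L(2)) auto
qed

text \<open>With \<open>q\<close> before and \<open>p\<close> after raising, \<open>p = q D\<close>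
  and \<open>p' = q (D g + 1 + t g2)\<close>. So the logarithmic derivatives differ by
  \<open>(1 + t g2) / D\<close>, where \<open>|D| \<ge> Im D \<ge> Im z\<close> because
  \<open>Im g \<le> 0\<close>.\<close>

lemma herm_raise_log_deriv:
  fixes M :: "real multiset"
  assumes t: "t > 0" and z: "Im z > 0"
  defines "g \<equiv> log_deriv (herm_roots t M) z"
  shows "Im z \<le> Im (z - of_real \<alpha> - of_real t * g)"
    "poly (cpoly (herm t (add_mset \<alpha> M))) z = poly (cpoly (herm t M)) z * (z - of_real \<alpha> - of_real t * g)"
    "cmod (log_deriv (herm_roots t (add_mset \<alpha> M)) z - g) \<le> (1 + t * size M / (Im z)\<^sup>2) / Im z"
proof -
  define q where "q = cpoly (herm t M)"
  define p where "p = cpoly (herm t (add_mset \<alpha> M))"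
  define g2 where "g2 = (\<Sum>r\<in>herm_roots t M. 1 / (z - of_real r)\<^sup>2)"
  define D where "D = z - of_real \<alpha> - of_real t * g"
  have pq: "p = raise (of_real t) (of_real \<alpha>) q" by (simp add: p_def q_def herm_add_mset cpoly_raise)
  note Q = herm_log_deriv[OF t z, of M, folded q_def g_def g2_def]
  note P = herm_log_deriv(1,2)[OF t z, of "add_mset \<alpha> M", folded p_def]
  have "Im g \<le> 0" unfolding g_def by (rule Im_log_deriv_nonpos[OF z])
  then show Im: "Im z \<le> Im D" using t by (simp add: D_def mult_nonneg_nonpos)
  then have D: "Im z \<le> cmod D" using abs_Im_le_cmod[of D] by linarith
  then have D0: "D \<noteq> 0" using z by auto
  have pz: "poly p z = poly q z * D"
    by (simp add: pq raise_def Q D_def algebra_simps)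
  then show "poly (cpoly (herm t (add_mset \<alpha> M))) z = poly (cpoly (herm t M)) z * D"
    by (simp add: p_def q_def)
  have "poly (pderiv p) z = poly q z + (z - of_real \<alpha>) * poly (pderiv q) z - of_real t * poly (pderiv (pderiv q)) z"
    by (simp add: pq pderiv_raise) (simp add: raise_def algebra_simps)
  also have "\<dots> = poly q z * (D * g + (1 + of_real t * g2))"
    unfolding Q(2,3) by (simp add: D_def algebra_simps power2_eq_square)
  finally have "poly q z * D * log_deriv (herm_roots t (add_mset \<alpha> M)) z = poly q z * (D * g + (1 + of_real t * g2))"
    using P(2) by (simp add: pz)
  then have "poly q z * (D * (log_deriv (herm_roots t (add_mset \<alpha> M)) z - g)) = poly q z * (1 + of_real t * g2)"
    by (simp add: algebra_simps)
  then have "D * (log_deriv (herm_roots t (add_mset \<alpha> M)) z - g) = 1 + of_real t * g2"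
    using Q(1) by simp
  then have eq: "log_deriv (herm_roots t (add_mset \<alpha> M)) z - g = (1 + of_real t * g2) / D"
    using D0 by (simp add: field_simps)
  have "card (herm_roots t M) = size M"
    using herm_simple_real_roots[OF t, of M] by (simp add: herm_roots_def)
  then have "cmod g2 \<le> size M / (Im z)\<^sup>2"
    using norm_sum_inverse_power_le[OF z, where k = 2 and R = "herm_roots t M"] by (simp add: g2_def)
  then have "cmod (1 + of_real t * g2) \<le> 1 + t * (size M / (Im z)\<^sup>2)"
    using t by (intro norm_triangle_le add_mono) (auto simp: norm_mult simp del: times_divide_eq_right)
  then show "cmod (log_deriv (herm_roots t (add_mset \<alpha> M)) z - g) \<le> (1 + t * size M / (Im z)\<^sup>2) / Im z"
    unfolding eq norm_divide using D z t by (intro frac_le) (auto intro!: add_nonneg_nonneg)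
qed

context sources
begin

definition scaled_roots :: "nat \<Rightarrow> real set" where
  "scaled_roots n = herm_roots (1 / (2 * real n)) (hermite_points n A)"

text \<open>Normalised by \<open>n\<close> and not by the number of zeros: for \<open>n > 0\<close>
  and nonempty \<open>A\<close> this is \<open>card A\<close> times the Stieltjes transform of the
  zero distribution.\<close>

definition stieltjes :: "nat \<Rightarrow> complex \<Rightarrow> complex" where
  "stieltjes n z = log_deriv (scaled_roots n) z / of_nat n"

lemma scaled_roots:
  assumes "n > 0"
  shows "finite (scaled_roots n)" "card (scaled_roots n) = n * card A"
  using herm_simple_real_roots[of "1 / (2 * real n)" "hermite_points n A"] assms
  by (simp_all add: scaled_roots_def herm_roots_def hermite_points_def)

text \<open>With \<open>v \<alpha>\<close> in place of \<open>u\<close> the equation for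
  \<open>u\<close> is exact (\<open>u_eq\<close>), from the two expressions of the polynomial and of
  its derivative by those with one source removed. Since \<open>u\<close> and
  \<open>v \<alpha>\<close> differ by at most \<open>\<delta> = O(1/n)\<close> and all denominators
  have modulus at least \<open>Im z\<close>, the replacement costs \<open>O(1/n)\<close>.\<close>

lemma approx_subordination:
  assumes n: "n > 0" and z: "Im z > 0"
  shows "cmod (subord (z - stieltjes n z / 2) - z) \<le>
      card A * (1 + card A / (2 * (Im z)\<^sup>2)) / (4 * Im z ^ 3) / n"
    "Im z \<le> Im (z - stieltjes n z / 2)"
proof -
  define t where "t = 1 / (2 * real n)"
  define M where "M = hermite_points n A"
  define v where "v \<alpha> = log_deriv (herm_roots t (M - {#\<alpha>#})) z / of_nat n" for \<alpha>
  define u where "u = stieltjes n z"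
  have t: "t > 0" using n by (simp add: t_def)
  have tv: "of_real t * log_deriv (herm_roots t (M - {#\<alpha>#})) z = v \<alpha> / 2" for \<alpha>
    by (simp add: t_def v_def)
  have M: "add_mset \<alpha> (M - {#\<alpha>#}) = M" if "\<alpha> \<in> A" for \<alpha>
    using that n finite_A
    by (intro insert_DiffM) (simp add: M_def hermite_points_def flip: count_greater_zero_iff)
  have szM: "size M = n * card A" by (simp add: M_def hermite_points_def)
  note R = herm_raise_log_deriv[OF t z, where M = "M - {#\<alpha>#}" and \<alpha> = \<alpha> for \<alpha>, unfolded tv]
  have Imv: "Im z \<le> Im (z - of_real \<alpha> - v \<alpha> / 2)" for \<alpha> by (rule R(1))
  have "Im u \<le> 0"
    using Im_log_deriv_nonpos[OF z] by (simp add: u_def stieltjes_def divide_nonpos_nonneg)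
  then show Imu: "Im z \<le> Im (z - stieltjes n z / 2)" by (simp add: u_def)
  define \<delta> where "\<delta> = (1 + card A / (2 * (Im z)\<^sup>2)) / Im z / n"
  have uv: "cmod (u - v \<alpha>) \<le> \<delta>" if "\<alpha> \<in> A" for \<alpha>
  proof -
    have "u - v \<alpha> = (log_deriv (herm_roots t M) z - log_deriv (herm_roots t (M - {#\<alpha>#})) z) / of_nat n"
      by (simp add: u_def v_def stieltjes_def scaled_roots_def diff_divide_distrib flip: t_def M_def)
    then have "cmod (u - v \<alpha>) \<le> (1 + t * size (M - {#\<alpha>#}) / (Im z)\<^sup>2) / Im z / n"
      using divide_right_mono[OF R(3)[of \<alpha>, unfolded M[OF that]], of "real n"] by (simp add: norm_divide)
    also have "\<dots> \<le> (1 + t * size M / (Im z)\<^sup>2) / Im z / n"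
      using t z n by (intro divide_right_mono add_left_mono mult_left_mono)
        (auto simp: size_Diff_submset intro: size_mset_mono)
    also have "\<dots> = \<delta>" using n by (simp add: \<delta>_def szM t_def)
    finally show ?thesis .
  qed
  have u_eq: "u = (\<Sum>\<alpha>\<in>A. 1 / (z - of_real \<alpha> - v \<alpha> / 2))"
  proof -
    let ?p = "poly (cpoly (herm t M)) z"
    have p0: "?p \<noteq> 0" by (rule herm_log_deriv(1)[OF t z])
    \<comment> \<open>Every source has multiplicity \<open>n\<close>, so the multiset sum in
      \<open>pderiv_herm\<close> is \<open>n\<close> times a sum over \<open>A\<close>.\<close>
    have "pderiv (herm t M) = (\<Sum>\<alpha>\<in>A. smult (of_nat n) (herm t (M - {#\<alpha>#})))"
    proof -
      have "(\<Sum>\<alpha>\<in>#repeat_mset k (mset_set A). f \<alpha>) = (\<Sum>\<alpha>\<in>A. smult (of_nat k) (f \<alpha>))" for f :: "real \<Rightarrow> real poly" and k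
        by (induction k) (simp_all add: sum_unfold_sum_mset smult_add_left flip: sum.distrib sum_mset.distrib)
      then show ?thesis unfolding pderiv_herm by (simp add: M_def hermite_points_def)
    qed
    then have "cpoly (pderiv (herm t M)) = (\<Sum>\<alpha>\<in>A. smult (of_nat n) (cpoly (herm t (M - {#\<alpha>#}))))"
      by (intro poly_eqI) (simp add: coeff_map_poly coeff_sum)
    moreover have "cpoly (pderiv p) = pderiv (cpoly p)" for p
      by (intro poly_eqI) (simp add: coeff_map_poly coeff_pderiv)
    ultimately have "poly (pderiv (cpoly (herm t M))) z = (\<Sum>\<alpha>\<in>A. of_nat n * poly (cpoly (herm t (M - {#\<alpha>#}))) z)"
      by (simp add: poly_sum)
    also have "\<dots> = (\<Sum>\<alpha>\<in>A. of_nat n * (?p / (z - of_real \<alpha> - v \<alpha> / 2)))"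
    proof (rule sum.cong)
      fix \<alpha> assume "\<alpha> \<in> A"
      have "z - of_real \<alpha> - v \<alpha> / 2 \<noteq> 0"
        using Imv[of \<alpha>] z by (metis not_le zero_complex.simps(2))
      then show "of_nat n * poly (cpoly (herm t (M - {#\<alpha>#}))) z = of_nat n * (?p / (z - of_real \<alpha> - v \<alpha> / 2))"
        using R(2)[of \<alpha>] unfolding M[OF \<open>\<alpha> \<in> A\<close>] by simp
    qed simp
    also have "\<dots> = of_nat n * ?p * (\<Sum>\<alpha>\<in>A. 1 / (z - of_real \<alpha> - v \<alpha> / 2))"
      by (simp add: sum_distrib_left)
    finally have "?p * log_deriv (herm_roots t M) z = of_nat n * ?p * (\<Sum>\<alpha>\<in>A. 1 / (z - of_real \<alpha> - v \<alpha> / 2))"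
      by (simp add: herm_log_deriv(2)[OF t z])
    then have "log_deriv (herm_roots t M) z = of_nat n * (\<Sum>\<alpha>\<in>A. 1 / (z - of_real \<alpha> - v \<alpha> / 2))"
      using p0 by simp
    then show ?thesis
      using n by (simp add: u_def stieltjes_def scaled_roots_def flip: t_def M_def)
  qed
  have diff_le: "cmod (1 / (z - u / 2 - of_real \<alpha>) - 1 / (z - of_real \<alpha> - v \<alpha> / 2)) \<le> \<delta> / (2 * (Im z)\<^sup>2)"
    if "\<alpha> \<in> A" for \<alpha>
  proof -
    define a where "a = z - u / 2 - of_real \<alpha>"
    define b where "b = z - of_real \<alpha> - v \<alpha> / 2"
    have a: "Im z \<le> cmod a" using Imu abs_Im_le_cmod[of a] by (simp add: a_def u_def)
    have b: "Im z \<le> cmod b" using Imv[of \<alpha>] abs_Im_le_cmod[of b] by (simp add: b_def)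
    have nz: "a \<noteq> 0" "b \<noteq> 0" using a b z by auto
    then have "1 / a - 1 / b = (u - v \<alpha>) / 2 / (a * b)"
      by (simp add: divide_simps) (simp add: a_def b_def algebra_simps)
    then have "cmod (1 / a - 1 / b) = cmod (u - v \<alpha>) / 2 / (cmod a * cmod b)"
      by (simp add: norm_divide norm_mult)
    also have "\<dots> \<le> \<delta> / 2 / (Im z * Im z)"
      using uv[OF that] order_trans[OF norm_ge_zero uv[OF that]] a b z
      by (intro frac_le mult_mono) auto
    finally show ?thesis by (simp add: a_def b_def power2_eq_square)
  qed
  have "subord (z - u / 2) - z = (\<Sum>\<alpha>\<in>A. 1 / (z - u / 2 - of_real \<alpha>) - 1 / (z - of_real \<alpha> - v \<alpha> / 2)) / 2"
    unfolding sum_subtractf u_eq[symmetric] by (simp add: subord_def diff_divide_distrib)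
  then have "cmod (subord (z - u / 2) - z) = cmod (\<Sum>\<alpha>\<in>A. 1 / (z - u / 2 - of_real \<alpha>) - 1 / (z - of_real \<alpha> - v \<alpha> / 2)) / 2"
    by (simp only: norm_divide) simp
  also have "\<dots> \<le> (\<Sum>\<alpha>\<in>A. \<delta> / (2 * (Im z)\<^sup>2)) / 2"
    by (intro divide_right_mono sum_norm_le diff_le) auto
  also have "\<dots> = card A * (1 + card A / (2 * (Im z)\<^sup>2)) / (4 * Im z ^ 3) / n"
    by (simp add: \<delta>_def power2_eq_square power3_eq_cube)
  finally show "cmod (subord (z - stieltjes n z / 2) - z) \<le>
      card A * (1 + card A / (2 * (Im z)\<^sup>2)) / (4 * Im z ^ 3) / n" by (simp add: u_def)
qed

text \<open>The inverse of \<open>subord\<close>; outside the closed upper half-plane its values are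
  arbitrary.\<close>

definition \<omega> :: "complex \<Rightarrow> complex" where
  "\<omega> = inv_into subord_dom subord"

text \<open>The points \<open>w n\<close> are approximate preimages of \<open>z\<close>, so
  properness makes them converge to a true preimage. Surjectivity onto the open half-plane is thus a
  by-product of the polynomials.\<close>

lemma stieltjes_limit:
  assumes z: "Im z > 0"
  shows "z \<in> subord ` subord_dom" "(\<lambda>n. stieltjes n z) \<longlonglongrightarrow> 2 * (z - \<omega> z)"
proof -
  define w where "w n = z - stieltjes n z / 2" for n
  define C where "C = card A * (1 + card A / (2 * (Im z)\<^sup>2)) / (4 * Im z ^ 3)"
  have "(\<lambda>n. subord (w n) - z) \<longlonglongrightarrow> 0"
  proof (rule Lim_null_comparison)
    show "\<forall>\<^sub>F n in sequentially. norm (subord (w n) - z) \<le> C / n"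
      using eventually_gt_at_top[of 0]
      by eventually_elim (use approx_subordination(1)[OF _ z] in \<open>simp add: w_def C_def\<close>)
    show "(\<lambda>n. C / real n) \<longlonglongrightarrow> 0" by real_asymp
  qed
  then have lim: "(\<lambda>n. subord (w n)) \<longlonglongrightarrow> z" by (simp add: LIM_zero_iff)
  have "(\<lambda>n. Im (subord (w n))) \<longlonglongrightarrow> Im z" by (intro tendsto_intros lim)
  then have "\<forall>\<^sub>F n in sequentially. Im (subord (w n)) > 0"
    using z by (rule order_tendstoD)
  with eventually_gt_at_top[of 0] have "\<forall>\<^sub>F n in sequentially. w n \<in> subord_dom"
  proof eventually_elim
    case (elim n)
    \<comment> \<open>As \<open>Im w\<close> is positive,
      \<open>Im (subord w) = Im w (1 - spread w)\<close> is positive only if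
      \<open>spread w < 1\<close>.\<close>
    have I: "Im (w n) > 0" using approx_subordination(2)[OF elim(1) z] z by (simp add: w_def)
    then have "spread (w n) < 1" using elim(2) by (simp add: Im_subord zero_less_mult_iff)
    with I show ?case by (auto simp: subord_dom_def)
  qed
  then obtain k where k: "\<And>n. n \<ge> k \<Longrightarrow> w n \<in> subord_dom" by (auto simp: eventually_sequentially)
  from subord_proper[of "\<lambda>n. w (n + k)" z] k LIMSEQ_ignore_initial_segment[OF lim, of k]
  obtain l where l: "l \<in> subord_dom" "subord l = z" "(\<lambda>n. w (n + k)) \<longlonglongrightarrow> l" by auto
  then show "z \<in> subord ` subord_dom" by auto
  have "\<omega> z = l" unfolding \<omega>_def using l subord_inj by (auto simp: inv_into_f_eq)
  moreover have "w \<longlonglongrightarrow> l" using l(3) by (rule LIMSEQ_offset)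
  ultimately have "(\<lambda>n. 2 * (z - w n)) \<longlonglongrightarrow> 2 * (z - \<omega> z)" by (intro tendsto_intros) auto
  then show "(\<lambda>n. stieltjes n z) \<longlonglongrightarrow> 2 * (z - \<omega> z)" by (simp add: w_def)
qed

text \<open>A real \<open>z\<close> is approached from above, and properness supplies the limit of
  the preimages.\<close>

lemma subord_surj:
  assumes "Im z \<ge> 0"
  shows "z \<in> subord ` subord_dom"
proof (cases "Im z = 0")
  case True
  define y where "y n = z + \<i> * of_real (1 / Suc n)" for n
  have "\<exists>w\<in>subord_dom. y n = subord w" for n
    using stieltjes_limit(1)[of "y n"] True by (auto simp: y_def)
  then obtain w where w: "\<And>n. w n \<in> subord_dom" "\<And>n. y n = subord (w n)" by metis
  have "(\<lambda>n. 1 / real (Suc n)) \<longlonglongrightarrow> 0" by real_asymp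
  then have "y \<longlonglongrightarrow> z + \<i> * of_real 0" unfolding y_def by (intro tendsto_intros)
  then have "(\<lambda>n. subord (w n)) \<longlonglongrightarrow> z" by (simp flip: w)
  from subord_proper[OF w(1) this] show ?thesis by auto
qed (use assms stieltjes_limit in auto)

lemma \<omega>:
  assumes "Im z \<ge> 0"
  shows "\<omega> z \<in> subord_dom" "subord (\<omega> z) = z"
  unfolding \<omega>_def using subord_surj[OF assms] by (auto simp: inv_into_into f_inv_into_f)

lemma \<omega>_subord: "w \<in> subord_dom \<Longrightarrow> \<omega> (subord w) = w"
  unfolding \<omega>_def using subord_inj by simp

lemma continuous_on_\<omega>: "continuous_on {z. Im z \<ge> 0} \<omega>"
  unfolding continuous_on_sequentially
proof (intro allI ballI impI)
  fix x z assume a: "z \<in> {z. Im z \<ge> 0}" "(\<forall>n. x n \<in> {z. Im z \<ge> 0}) \<and> x \<longlonglongrightarrow> z"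
  then have "\<exists>l\<in>subord_dom. subord l = z \<and> (\<lambda>n. \<omega> (x n)) \<longlonglongrightarrow> l"
    by (intro subord_proper) (auto simp: \<omega>)
  then show "(\<omega> \<circ> x) \<longlonglongrightarrow> \<omega> z" using \<omega>_subord by (auto simp: comp_def)
qed

end

section \<open>Weak convergence of the zero distribution\<close>

definition cauchy_density :: "real \<Rightarrow> real" where
  "cauchy_density s = inverse (1 + s\<^sup>2) / pi"

lemma cauchy_density_nonneg: "0 \<le> cauchy_density s"
  by (simp add: cauchy_density_def)

lemma has_bochner_integral_cauchy_density: "has_bochner_integral lborel cauchy_density 1"
proof -
  have "integrable lborel (\<lambda>x::real. inverse (1 + x\<^sup>2))"
    using integrable_inverse_1_plus_square by (simp add: set_integrable_def)
  moreover have "(\<integral>x. inverse (1 + x\<^sup>2) \<partial>lborel) = pi"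
    using LBINT_inverse_1_plus_square by (simp add: interval_lebesgue_integral_def set_lebesgue_integral_def)
  ultimately show ?thesis
    unfolding cauchy_density_def by (simp add: has_bochner_integral_iff)
qed

text \<open>For positive \<epsilon> this is the Cauchy density of width \<epsilon>, equal to
  \<open>- Im (1 / (y + i \<epsilon>)) / pi\<close>; this links it to Stieltjes transforms.\<close>

definition poisson :: "real \<Rightarrow> real \<Rightarrow> real" where
  "poisson \<epsilon> y = \<epsilon> / (pi * (y\<^sup>2 + \<epsilon>\<^sup>2))"

lemma poisson_bounds:
  assumes "\<epsilon> > 0"
  shows "0 \<le> poisson \<epsilon> y" "poisson \<epsilon> y \<le> 1 / (pi * \<epsilon>)"
proof -
  show "0 \<le> poisson \<epsilon> y" using assms by (simp add: poisson_def)
  have "poisson \<epsilon> y \<le> \<epsilon> / (pi * \<epsilon>\<^sup>2)"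
    unfolding poisson_def using assms by (intro divide_left_mono mult_left_mono) (auto intro!: mult_pos_pos add_nonneg_pos)
  then show "poisson \<epsilon> y \<le> 1 / (pi * \<epsilon>)" using assms by (simp add: power2_eq_square)
qed

lemma continuous_on_poisson [continuous_intros]:
  assumes "\<epsilon> > 0" "continuous_on S f"
  shows "continuous_on S (\<lambda>x. poisson \<epsilon> (f x))"
proof -
  have "y\<^sup>2 + \<epsilon>\<^sup>2 \<noteq> 0" for y using assms(1) by (simp add: sum_power2_eq_zero_iff)
  then show ?thesis unfolding poisson_def using assms(2) by (intro continuous_intros) auto
qed

lemma integrable_compact_support:
  fixes f :: "real \<Rightarrow> real"
  assumes "continuous_on UNIV f" "\<And>x. \<bar>x\<bar> > K \<Longrightarrow> f x = 0"
  shows "integrable lborel f"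
proof -
  have "integrable lborel (\<lambda>x. indicator {-K..K} x *\<^sub>R f x)"
    by (intro borel_integrable_compact continuous_on_subset[OF assms(1)]) auto
  also have "(\<lambda>x. indicator {-K..K} x *\<^sub>R f x) = f"
  proof
    fix x
    show "indicator {-K..K} x *\<^sub>R f x = f x"
      using assms(2)[of x] by (cases "\<bar>x\<bar> > K") (auto simp: indicator_def)
  qed
  finally show ?thesis .
qed

lemma bounded_compact_support:
  fixes f :: "real \<Rightarrow> real"
  assumes "continuous_on UNIV f" "\<And>x. \<bar>x\<bar> > K \<Longrightarrow> f x = 0"
  obtains B where "B \<ge> 0" "\<And>x. \<bar>f x\<bar> \<le> B"
proof -
  have "bounded (f ` {-K..K})"
    by (intro compact_imp_bounded compact_continuous_image continuous_on_subset[OF assms(1)]) auto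
  then obtain B where B: "B > 0" "\<And>x. x \<in> {-K..K} \<Longrightarrow> \<bar>f x\<bar> \<le> B" by (auto simp: bounded_pos)
  have "\<bar>f x\<bar> \<le> B" for x
  proof (cases "\<bar>x\<bar> > K")
    case False
    then show ?thesis by (intro B(2)) auto
  qed (use assms(2) B(1) in auto)
  with B(1) show ?thesis by (intro that[of B]) auto
qed

lemma uniformly_continuous_compact_support:
  fixes f :: "real \<Rightarrow> real"
  assumes "continuous_on UNIV f" "\<And>x. \<bar>x\<bar> > K \<Longrightarrow> f x = 0" "\<eta> > 0"
  obtains \<delta> where "\<delta> > 0" "\<And>x y. \<bar>x - y\<bar> < \<delta> \<Longrightarrow> \<bar>f x - f y\<bar> < \<eta>"
proof -
  have "uniformly_continuous_on {-(K+1)..K+1} f"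
    by (intro compact_uniformly_continuous continuous_on_subset[OF assms(1)]) auto
  then obtain d where d: "d > 0"
    "\<And>x y. x \<in> {-(K+1)..K+1} \<Longrightarrow> y \<in> {-(K+1)..K+1} \<Longrightarrow> dist y x < d \<Longrightarrow> dist (f y) (f x) < \<eta>"
    using assms(3) unfolding uniformly_continuous_on_def by meson
  show ?thesis
  \<comment> \<open>With distance below 1, a point outside the enlarged interval forces both points
    outside \<open>[-K, K]\<close>.\<close>
  proof (rule that[of "min d 1"])
    fix x y :: real assume xy: "\<bar>x - y\<bar> < min d 1"
    show "\<bar>f x - f y\<bar> < \<eta>"
    proof (cases "x \<in> {-(K+1)..K+1} \<and> y \<in> {-(K+1)..K+1}")
      case True
      then show ?thesis using d(2)[of y x] xy by (simp add: dist_real_def)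
    next
      case False
      then have "\<bar>x\<bar> > K" "\<bar>y\<bar> > K" using xy by auto
      then show ?thesis using assms by simp
    qed
  qed (use d in auto)
qed

text \<open>After \<open>x = r + \<epsilon> s\<close> the error integrand is bounded by \<eta>/2
  times the Cauchy density plus \<open>h k\<close>, which does not depend on \<open>r\<close> and
  whose integral vanishes in the limit by dominated convergence. Uniformity in \<open>r\<close> is
  needed because \<open>r\<close> will run over zeros that depend on \<open>n\<close>.\<close>

lemma poisson_integral_converges_uniformly:
  fixes f :: "real \<Rightarrow> real"
  assumes f: "continuous_on UNIV f" "\<And>x. \<bar>x\<bar> > K \<Longrightarrow> f x = 0" and \<eta>: "\<eta> > 0"
  shows "\<forall>\<^sub>F k in sequentially. \<forall>r. \<bar>(\<integral>x. f x * poisson (1 / Suc k) (x - r) \<partial>lborel) - f r\<bar> \<le> \<eta>"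
proof -
  obtain B where B: "B \<ge> 0" "\<And>x. \<bar>f x\<bar> \<le> B"
    using bounded_compact_support[OF f] by blast
  obtain \<delta> where \<delta>: "\<delta> > 0" "\<And>x y. \<bar>x - y\<bar> < \<delta> \<Longrightarrow> \<bar>f x - f y\<bar> < \<eta> / 2"
    using uniformly_continuous_compact_support[OF f half_gt_zero[OF \<eta>]] by blast
  \<comment> \<open>Chosen so that \<open>C |s| / Suc k\<close> reaches the trivial bound
    \<open>2 B\<close> as soon as uniform continuity at scale \<delta> fails to apply.\<close>
  define C where "C = 2 * B / \<delta>"
  have C: "C \<ge> 0" using B \<delta> by (simp add: C_def)
  define h where "h k s = min (2 * B) (C * \<bar>s\<bar> / Suc k) * cauchy_density s" for k and s :: real
  note cd = has_bochner_integral_cauchy_density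
  have cdi: "integrable lborel cauchy_density" using cd by (simp add: has_bochner_integral_iff)
  then have cdm [measurable]: "cauchy_density \<in> borel_measurable borel" by auto
  have fm [measurable]: "f \<in> borel_measurable borel" by (rule borel_measurable_continuous_onI[OF f(1)])
  have hm [measurable]: "h k \<in> borel_measurable lborel" for k unfolding h_def by measurable
  have hb: "\<bar>h k s\<bar> \<le> 2 * B * cauchy_density s" for k s
    unfolding h_def using B C by (auto simp: abs_mult cauchy_density_nonneg intro!: mult_right_mono)
  have hi: "integrable lborel (h k)" for k
    by (rule Bochner_Integration.integrable_bound[OF integrable_mult_right[OF cdi, of "2 * B"]])
      (use hb[of k] in \<open>auto simp: abs_mult B cauchy_density_nonneg\<close>)
  have "(\<lambda>k. \<integral>s. h k s \<partial>lborel) \<longlonglongrightarrow> (\<integral>s. 0 \<partial>(lborel :: real measure))"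
  proof (rule integral_dominated_convergence[where w = "\<lambda>s. 2 * B * cauchy_density s"])
    show "AE s in lborel. (\<lambda>k. h k s) \<longlonglongrightarrow> 0"
    proof (rule AE_I2)
      fix s :: real
      have "(\<lambda>k. C * \<bar>s\<bar> / Suc k) \<longlonglongrightarrow> 0" by real_asymp
      then have "(\<lambda>k. min (2 * B) (C * \<bar>s\<bar> / Suc k) * cauchy_density s) \<longlonglongrightarrow> min (2 * B) 0 * cauchy_density s"
        by (intro tendsto_intros)
      then show "(\<lambda>k. h k s) \<longlonglongrightarrow> 0" using B by (simp add: h_def)
    qed
  qed (use hb cdi in auto)
  then have "\<forall>\<^sub>F k in sequentially. (\<integral>s. h k s \<partial>lborel) < \<eta> / 2"
    using \<eta> by (intro order_tendstoD) auto
  then show ?thesis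
  proof eventually_elim
    case (elim k)
    define \<epsilon> where "\<epsilon> = 1 / real (Suc k)"
    have \<epsilon>: "\<epsilon> > 0" by (simp add: \<epsilon>_def)
    show ?case
    proof
      fix r
      have "(\<integral>x. f x * poisson \<epsilon> (x - r) \<partial>lborel) = (\<integral>s. \<epsilon> * (f (r + \<epsilon> * s) * poisson \<epsilon> (r + \<epsilon> * s - r)) \<partial>lborel)"
        using \<epsilon> by (subst lborel_integral_real_affine[where c = \<epsilon> and t = r]) auto
      also have "\<dots> = (\<integral>s. f (r + \<epsilon> * s) * cauchy_density s \<partial>lborel)"
      proof (rule Bochner_Integration.integral_cong)
        fix s :: real
        have "(\<epsilon> * s)\<^sup>2 + \<epsilon>\<^sup>2 = \<epsilon> * \<epsilon> * (1 + s\<^sup>2)"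
          by (simp add: power2_eq_square algebra_simps)
        then have "\<epsilon> * poisson \<epsilon> (\<epsilon> * s) = cauchy_density s"
          using \<epsilon> by (simp add: poisson_def cauchy_density_def inverse_eq_divide)
        then show "\<epsilon> * (f (r + \<epsilon> * s) * poisson \<epsilon> (r + \<epsilon> * s - r)) = f (r + \<epsilon> * s) * cauchy_density s"
          by (simp add: algebra_simps)
      qed simp
      finally have eq: "(\<integral>x. f x * poisson \<epsilon> (x - r) \<partial>lborel) = (\<integral>s. f (r + \<epsilon> * s) * cauchy_density s \<partial>lborel)" .
      have i1: "integrable lborel (\<lambda>s. f (r + \<epsilon> * s) * cauchy_density s)"
        by (rule Bochner_Integration.integrable_bound[OF integrable_mult_right[OF cdi, of B]])
          (auto simp: abs_mult B cauchy_density_nonneg intro!: mult_right_mono)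
      have "(\<integral>s. f r * cauchy_density s \<partial>lborel) = f r"
        using cd by (simp add: has_bochner_integral_iff)
      then have "(\<integral>x. f x * poisson \<epsilon> (x - r) \<partial>lborel) - f r =
          (\<integral>s. f (r + \<epsilon> * s) * cauchy_density s - f r * cauchy_density s \<partial>lborel)"
        unfolding eq by (subst Bochner_Integration.integral_diff) (auto intro: i1 cdi)
      also have "\<bar>\<dots>\<bar> \<le> (\<integral>s. \<bar>f (r + \<epsilon> * s) * cauchy_density s - f r * cauchy_density s\<bar> \<partial>lborel)"
        by (rule integral_abs_bound)
      also have "\<dots> \<le> (\<integral>s. \<eta> / 2 * cauchy_density s + h k s \<partial>lborel)"
      proof (rule integral_mono)
        fix s :: real
        have "\<bar>f (r + \<epsilon> * s) - f r\<bar> \<le> \<eta> / 2 + min (2 * B) (C * \<bar>s\<bar> / Suc k)"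
        proof (cases "\<bar>\<epsilon> * s\<bar> < \<delta>")
          case True
          then have "\<bar>f (r + \<epsilon> * s) - f r\<bar> < \<eta> / 2" by (intro \<delta>(2)) simp
          moreover have "0 \<le> min (2 * B) (C * \<bar>s\<bar> / Suc k)" using B C by auto
          ultimately show ?thesis by linarith
        next
          case False
          then have "\<delta> \<le> \<bar>s\<bar> / Suc k" using \<epsilon> by (simp add: abs_mult \<epsilon>_def)
          then have "2 * B \<le> C * (\<bar>s\<bar> / Suc k)"
            using mult_left_mono[of \<delta> "\<bar>s\<bar> / Suc k" C] C \<delta>(1) by (simp add: C_def)
          then have "min (2 * B) (C * \<bar>s\<bar> / Suc k) = 2 * B" by simp
          moreover have "\<bar>f (r + \<epsilon> * s) - f r\<bar> \<le> 2 * B"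
            using B(2)[of "r + \<epsilon> * s"] B(2)[of r] by linarith
          ultimately show ?thesis using \<eta> by linarith
        qed
        then have "\<bar>f (r + \<epsilon> * s) - f r\<bar> * cauchy_density s \<le> (\<eta> / 2 + min (2 * B) (C * \<bar>s\<bar> / Suc k)) * cauchy_density s"
          by (intro mult_right_mono cauchy_density_nonneg)
        then show "\<bar>f (r + \<epsilon> * s) * cauchy_density s - f r * cauchy_density s\<bar> \<le> \<eta> / 2 * cauchy_density s + h k s"
          by (simp add: h_def abs_mult cauchy_density_nonneg distrib_right flip: left_diff_distrib)
      qed (intro integrable_abs Bochner_Integration.integrable_diff Bochner_Integration.integrable_add
          Bochner_Integration.integrable_mult_right i1 cdi hi)+
      also have "\<dots> = \<eta> / 2 + (\<integral>s. h k s \<partial>lborel)"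
        using cd by (subst Bochner_Integration.integral_add) (auto simp: has_bochner_integral_iff hi)
      also have "\<dots> \<le> \<eta>" using elim by simp
      finally show "\<bar>(\<integral>x. f x * poisson (1 / Suc k) (x - r) \<partial>lborel) - f r\<bar> \<le> \<eta>"
        by (simp add: \<epsilon>_def)
    qed
  qed
qed

context sources
begin

text \<open>Stieltjes inversion: on the real axis the limit \<open>2 (z - \<omega> z)\<close> has
  imaginary part \<open>-2 Im (\<omega> z)\<close>; dividing by \<open>card A\<close> normalises the
  mass.\<close>

definition limit_density :: "real \<Rightarrow> real" where
  "limit_density x = 2 * Im (\<omega> (of_real x)) / (card A * pi)"

definition smoothed_density :: "real \<Rightarrow> real \<Rightarrow> real" where
  "smoothed_density \<epsilon> x = 2 * (Im (\<omega> (Complex x \<epsilon>)) - \<epsilon>) / (card A * pi)"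

definition emp :: "nat \<Rightarrow> (real \<Rightarrow> real) \<Rightarrow> real" where
  "emp n f = (\<Sum>r\<in>scaled_roots n. f r) / (n * card A)"

lemma limit_density_nonneg: "limit_density x \<ge> 0"
  using \<omega>(1)[of "of_real x"] by (auto simp: limit_density_def subord_dom_def)

lemma continuous_on_limit_density: "continuous_on UNIV limit_density"
proof -
  have "continuous_on UNIV (\<lambda>x. \<omega> (of_real x))"
    by (rule continuous_on_compose2[OF continuous_on_\<omega>]) (auto intro!: continuous_intros)
  then show ?thesis unfolding limit_density_def divide_inverse by (intro continuous_intros)
qed

lemma continuous_on_smoothed_density:
  assumes "\<epsilon> \<ge> 0"
  shows "continuous_on UNIV (smoothed_density \<epsilon>)"
proof -
  have "continuous_on UNIV (\<lambda>x. \<omega> (Complex x \<epsilon>))"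
    by (rule continuous_on_compose2[OF continuous_on_\<omega>]) (use assms in \<open>auto intro!: continuous_intros\<close>)
  then show ?thesis unfolding smoothed_density_def divide_inverse by (intro continuous_intros)
qed

lemma emp_poisson:
  assumes "\<epsilon> > 0"
  shows "emp n (\<lambda>r. poisson \<epsilon> (x - r)) = - Im (stieltjes n (Complex x \<epsilon>)) / (card A * pi)"
proof -
  have "Im (log_deriv (scaled_roots n) (Complex x \<epsilon>)) = - pi * (\<Sum>r\<in>scaled_roots n. poisson \<epsilon> (x - r))"
    unfolding log_deriv_def Im_sum Im_inverse_diff_real sum_distrib_left
    by (intro sum.cong) (auto simp: poisson_def cmod_power2)
  then show ?thesis by (simp add: emp_def stieltjes_def)
qed

lemma emp_poisson_tendsto:
  assumes "\<epsilon> > 0"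
  shows "(\<lambda>n. emp n (\<lambda>r. poisson \<epsilon> (x - r))) \<longlonglongrightarrow> smoothed_density \<epsilon> x"
proof -
  have "(\<lambda>n. - Im (stieltjes n (Complex x \<epsilon>)) * (1 / (card A * pi))) \<longlonglongrightarrow>
      - Im (2 * (Complex x \<epsilon> - \<omega> (Complex x \<epsilon>))) * (1 / (card A * pi))"
    by (intro tendsto_intros stieltjes_limit) (use assms in simp)
  then show ?thesis using assms
    by (simp add: emp_poisson smoothed_density_def)
qed

lemma emp_le:
  assumes "n > 0" "\<And>r. f r \<le> C" "C \<ge> 0"
  shows "emp n f \<le> C"
proof -
  have "(\<Sum>r\<in>scaled_roots n. f r) \<le> (\<Sum>r\<in>scaled_roots n. C)" by (intro sum_mono assms)
  also have "\<dots> = C * (n * card A)" using scaled_roots[OF assms(1)] by simp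
  finally have "emp n f \<le> C * (n * card A) / (n * card A)"
    unfolding emp_def by (intro divide_right_mono) auto
  also have "\<dots> \<le> C" using assms by (cases "card A = 0") auto
  finally show ?thesis .
qed

lemma emp_diff: "emp n (\<lambda>r. f r - g r) = emp n f - emp n g"
  by (simp add: emp_def sum_subtractf diff_divide_distrib)

lemma emp_abs_diff_le:
  assumes "n > 0" "\<And>r. \<bar>f r - g r\<bar> \<le> C"
  shows "\<bar>emp n f - emp n g\<bar> \<le> C"
proof -
  have C: "C \<ge> 0" using assms(2)[of 0] by linarith
  have "f r - g r \<le> C" "g r - f r \<le> C" for r using assms(2)[of r] by linarith+
  then have "emp n (\<lambda>r. f r - g r) \<le> C" "emp n (\<lambda>r. g r - f r) \<le> C"
    using assms(1) C by (auto intro!: emp_le)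
  then show ?thesis unfolding emp_diff by linarith
qed

text \<open>Exchanging the finite sum with the integral moves the smoothing from \<open>f\<close> to
  the zero distribution, where it converges pointwise and is bounded by the maximum of the
  kernel.\<close>

lemma emp_poisson_integral_tendsto:
  assumes f: "continuous_on UNIV f" "\<And>x. \<bar>x\<bar> > K \<Longrightarrow> f x = 0" and \<epsilon>: "\<epsilon> > 0"
  shows "(\<lambda>n. emp n (\<lambda>r. \<integral>x. f x * poisson \<epsilon> (x - r) \<partial>lborel)) \<longlonglongrightarrow> (\<integral>x. f x * smoothed_density \<epsilon> x \<partial>lborel)"
proof -
  obtain B where B: "B \<ge> 0" "\<And>x. \<bar>f x\<bar> \<le> B"
    using bounded_compact_support[OF f] by blast
  have i: "integrable lborel (\<lambda>x. f x * poisson \<epsilon> (x - r))" for r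
    using f \<epsilon> by (intro integrable_compact_support[where K = K] continuous_intros) auto
  have eq: "emp n (\<lambda>r. \<integral>x. f x * poisson \<epsilon> (x - r) \<partial>lborel) = (\<integral>x. f x * emp n (\<lambda>r. poisson \<epsilon> (x - r)) \<partial>lborel)" for n
  proof -
    have "(\<Sum>r\<in>scaled_roots n. \<integral>x. f x * poisson \<epsilon> (x - r) \<partial>lborel) =
        (\<integral>x. (\<Sum>r\<in>scaled_roots n. f x * poisson \<epsilon> (x - r)) \<partial>lborel)"
      by (rule Bochner_Integration.integral_sum[symmetric]) (rule i)
    then show ?thesis by (simp add: emp_def flip: sum_distrib_left)
  qed
  have ii: "integrable lborel (\<lambda>x. f x * emp n (\<lambda>r. poisson \<epsilon> (x - r)))" for n
    using f \<epsilon> by (intro integrable_compact_support[where K = K])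
      (auto simp: emp_def divide_inverse intro!: continuous_intros)
  have iv: "integrable lborel (\<lambda>x. f x * smoothed_density \<epsilon> x)"
    using f \<epsilon> by (intro integrable_compact_support[where K = K] continuous_intros continuous_on_smoothed_density) auto
  \<comment> \<open>The shift to \<open>Suc n\<close> supplies the \<open>n > 0\<close> required by
    the uniform bound.\<close>
  have "(\<lambda>n. \<integral>x. f x * emp (Suc n) (\<lambda>r. poisson \<epsilon> (x - r)) \<partial>lborel) \<longlonglongrightarrow> (\<integral>x. f x * smoothed_density \<epsilon> x \<partial>lborel)"
  proof (rule integral_dominated_convergence[where w = "\<lambda>x. \<bar>f x\<bar> * (1 / (pi * \<epsilon>))"])
    show "AE x in lborel. (\<lambda>n. f x * emp (Suc n) (\<lambda>r. poisson \<epsilon> (x - r))) \<longlonglongrightarrow> f x * smoothed_density \<epsilon> x"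
      by (intro AE_I2 tendsto_intros LIMSEQ_Suc emp_poisson_tendsto \<epsilon>)
    show "AE x in lborel. norm (f x * emp (Suc n) (\<lambda>r. poisson \<epsilon> (x - r))) \<le> \<bar>f x\<bar> * (1 / (pi * \<epsilon>))" for n
    proof (rule AE_I2)
      fix x
      have "\<bar>emp (Suc n) (\<lambda>r. poisson \<epsilon> (x - r)) - emp (Suc n) (\<lambda>r. 0)\<bar> \<le> 1 / (pi * \<epsilon>)"
        by (rule emp_abs_diff_le) (simp_all add: abs_of_nonneg[OF poisson_bounds(1)[OF \<epsilon>]] poisson_bounds(2)[OF \<epsilon>])
      then have "\<bar>emp (Suc n) (\<lambda>r. poisson \<epsilon> (x - r))\<bar> \<le> 1 / (pi * \<epsilon>)" by (simp add: emp_def)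
      then show "norm (f x * emp (Suc n) (\<lambda>r. poisson \<epsilon> (x - r))) \<le> \<bar>f x\<bar> * (1 / (pi * \<epsilon>))"
        unfolding real_norm_def abs_mult by (rule mult_left_mono) simp
    qed
    show "integrable lborel (\<lambda>x. \<bar>f x\<bar> * (1 / (pi * \<epsilon>)))"
      by (intro integrable_mult_left integrable_abs integrable_compact_support[OF f])
  qed (use ii iv in auto)
  then show ?thesis unfolding eq by (rule LIMSEQ_imp_Suc)
qed

text \<open>Pointwise convergence is the continuity of \<omega> up to the real axis; domination
  holds because \<omega> moves points by at most \<open>card A\<close>.\<close>

lemma smoothed_density_integral_tendsto:
  assumes f: "continuous_on UNIV f" "\<And>x. \<bar>x\<bar> > K \<Longrightarrow> f x = 0"
  shows "(\<lambda>k. \<integral>x. f x * smoothed_density (1 / Suc k) x \<partial>lborel) \<longlonglongrightarrow> (\<integral>x. f x * limit_density x \<partial>lborel)"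
proof -
  \<comment> \<open>On \<open>[-K, K]\<close> the point \<open>z\<close> has modulus at most
    \<open>|K| + 1\<close>, \<omega> adds at most \<open>card A\<close>, and the subtracted height
    is at most 1.\<close>
  define C where "C = 2 * (\<bar>K\<bar> + 2 + card A) / (card A * pi)"
  have iv: "integrable lborel (\<lambda>x. f x * smoothed_density (1 / Suc k) x)" for k
    using f by (intro integrable_compact_support[where K = K] continuous_intros continuous_on_smoothed_density) auto
  have il: "integrable lborel (\<lambda>x. f x * limit_density x)"
    using f by (intro integrable_compact_support[where K = K] continuous_intros continuous_on_limit_density) auto
  show ?thesis
  proof (rule integral_dominated_convergence[where w = "\<lambda>x. \<bar>f x\<bar> * C"])
    show "AE x in lborel. (\<lambda>k. f x * smoothed_density (1 / Suc k) x) \<longlonglongrightarrow> f x * limit_density x"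
    proof (intro AE_I2 tendsto_intros)
      fix x :: real
      have e: "(\<lambda>k. 1 / real (Suc k)) \<longlonglongrightarrow> 0" by real_asymp
      then have "(\<lambda>k. Complex x (1 / Suc k)) \<longlonglongrightarrow> Complex x 0" by (intro tendsto_intros)
      then have "(\<lambda>k. \<omega> (Complex x (1 / Suc k))) \<longlonglongrightarrow> \<omega> (Complex x 0)"
        by (rule continuous_on_tendsto_compose[OF continuous_on_\<omega>]) auto
      then have "(\<lambda>k. 2 * (Im (\<omega> (Complex x (1 / Suc k))) - 1 / Suc k) * (1 / (card A * pi))) \<longlonglongrightarrow>
          2 * (Im (\<omega> (Complex x 0)) - 0) * (1 / (card A * pi))"
        by (intro tendsto_intros e)
      then show "(\<lambda>k. smoothed_density (1 / Suc k) x) \<longlonglongrightarrow> limit_density x"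
        by (simp add: smoothed_density_def limit_density_def complex_of_real_def)
    qed
    show "AE x in lborel. norm (f x * smoothed_density (1 / Suc k) x) \<le> \<bar>f x\<bar> * C" for k
    proof (rule AE_I2)
      fix x
      show "norm (f x * smoothed_density (1 / Suc k) x) \<le> \<bar>f x\<bar> * C"
      proof (cases "\<bar>x\<bar> > K")
        case False
        define z where "z = Complex x (1 / Suc k)"
        have z: "Im z \<ge> 0" by (simp add: z_def)
        have "cmod z \<le> \<bar>x\<bar> + 1 / Suc k" using cmod_le[of z] by (simp add: z_def)
        also have "1 / real (Suc k) \<le> 1" by simp
        finally have "cmod z \<le> \<bar>K\<bar> + 1" using False by linarith
        moreover have "cmod (z - \<omega> z) \<le> card A" using subord_near[OF \<omega>(1)[OF z]] \<omega>(2)[OF z] by simp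
        moreover have "cmod (\<omega> z) \<le> cmod z + cmod (z - \<omega> z)"
          by (metis norm_triangle_sub norm_minus_commute)
        moreover have "\<bar>Im (\<omega> z)\<bar> \<le> cmod (\<omega> z)" by (rule abs_Im_le_cmod)
        moreover have "\<bar>1 / real (Suc k)\<bar> \<le> 1" by simp
        ultimately have "\<bar>Im (\<omega> z) - 1 / Suc k\<bar> \<le> \<bar>K\<bar> + 2 + card A" by linarith
        then have "\<bar>smoothed_density (1 / Suc k) x\<bar> \<le> C"
          unfolding smoothed_density_def C_def abs_divide abs_mult z_def
          by (auto intro!: divide_right_mono simp: abs_mult)
        then show ?thesis unfolding real_norm_def abs_mult by (rule mult_left_mono) simp
      qed (use f in simp)
    qed
    show "integrable lborel (\<lambda>x. \<bar>f x\<bar> * C)"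
      by (intro integrable_mult_left integrable_abs integrable_compact_support[OF f])
  qed (use iv il in auto)
qed

text \<open>The height \<open>1 / Suc k\<close> is fixed first, making both smoothing errors small
  uniformly in \<open>n\<close>; only then does \<open>n\<close> tend to infinity.\<close>

lemma emp_tendsto_compact_support:
  assumes f: "continuous_on UNIV f" "\<And>x. \<bar>x\<bar> > K \<Longrightarrow> f x = 0"
  shows "(\<lambda>n. emp n f) \<longlonglongrightarrow> (\<integral>x. f x * limit_density x \<partial>lborel)"
proof (rule LIMSEQ_I)
  fix \<eta> :: real assume "\<eta> > 0"
  let ?L = "\<integral>x. f x * limit_density x \<partial>lborel"
  have "\<forall>\<^sub>F k in sequentially. dist (\<integral>x. f x * smoothed_density (1 / Suc k) x \<partial>lborel) ?L < \<eta> / 3"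
    by (rule tendstoD[OF smoothed_density_integral_tendsto[OF f]]) (use \<open>\<eta> > 0\<close> in auto)
  moreover have "\<forall>\<^sub>F k in sequentially. \<forall>r. \<bar>(\<integral>x. f x * poisson (1 / Suc k) (x - r) \<partial>lborel) - f r\<bar> \<le> \<eta> / 3"
    by (rule poisson_integral_converges_uniformly[OF f]) (use \<open>\<eta> > 0\<close> in auto)
  ultimately have "\<forall>\<^sub>F k in sequentially. dist (\<integral>x. f x * smoothed_density (1 / Suc k) x \<partial>lborel) ?L < \<eta> / 3 \<and>
      (\<forall>r. \<bar>(\<integral>x. f x * poisson (1 / Suc k) (x - r) \<partial>lborel) - f r\<bar> \<le> \<eta> / 3)"
    by eventually_elim simp
  then obtain k where k: "dist (\<integral>x. f x * smoothed_density (1 / Suc k) x \<partial>lborel) ?L < \<eta> / 3"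
    "\<And>r. \<bar>(\<integral>x. f x * poisson (1 / Suc k) (x - r) \<partial>lborel) - f r\<bar> \<le> \<eta> / 3"
    using eventually_happens'[OF sequentially_bot] by blast
  have "\<forall>\<^sub>F n in sequentially. dist (emp n (\<lambda>r. \<integral>x. f x * poisson (1 / Suc k) (x - r) \<partial>lborel))
      (\<integral>x. f x * smoothed_density (1 / Suc k) x \<partial>lborel) < \<eta> / 3"
    by (rule tendstoD[OF emp_poisson_integral_tendsto[OF f]]) (use \<open>\<eta> > 0\<close> in auto)
  with eventually_gt_at_top[of 0] have "\<forall>\<^sub>F n in sequentially. norm (emp n f - ?L) < \<eta>"
  proof eventually_elim
    case (elim n)
    have "\<bar>emp n (\<lambda>r. \<integral>x. f x * poisson (1 / Suc k) (x - r) \<partial>lborel) - emp n f\<bar> \<le> \<eta> / 3"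
      using elim(1) k(2) by (rule emp_abs_diff_le)
    then show ?case using elim(2) k(1) unfolding dist_real_def real_norm_def by linarith
  qed
  then show "\<exists>no. \<forall>n\<ge>no. norm (emp n f - ?L) < \<eta>" by (simp add: eventually_sequentially)
qed

section \<open>Tightness and bounded test functions\<close>

definition cutoff :: "real \<Rightarrow> real \<Rightarrow> real" where
  "cutoff K x = max 0 (min 1 (K + 1 - \<bar>x\<bar>))"

lemma continuous_on_cutoff: "continuous_on UNIV (cutoff K)"
  unfolding cutoff_def by (intro continuous_intros)

lemma cutoff_bounds: "0 \<le> cutoff K x" "cutoff K x \<le> 1" "\<bar>x\<bar> \<le> K \<Longrightarrow> cutoff K x = 1" "\<bar>x\<bar> > K + 1 \<Longrightarrow> cutoff K x = 0"
  by (auto simp: cutoff_def)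

text \<open>Beyond \<open>K\<close> the fraction \<open>K\<^sup>2 / (x\<^sup>2 + K\<^sup>2)\<close>
  is at most 1/2. Its average over the zeros can be read off from the Stieltjes transform at
  \<open>i K\<close>, so that single value controls the tail.\<close>

lemma one_minus_cutoff_le:
  assumes "K > 0"
  shows "1 - cutoff K x \<le> 2 * (1 - K\<^sup>2 / (x\<^sup>2 + K\<^sup>2))"
proof (cases "\<bar>x\<bar> \<le> K")
  case True
  have "0 < x\<^sup>2 + K\<^sup>2" using assms by (simp add: add_nonneg_pos)
  then have "K\<^sup>2 / (x\<^sup>2 + K\<^sup>2) \<le> 1" by simp
  with True show ?thesis by (simp add: cutoff_bounds)
next
  case False
  then have "K\<^sup>2 \<le> x\<^sup>2" using assms by (simp add: abs_le_square_iff[symmetric])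
  then have "K\<^sup>2 / (x\<^sup>2 + K\<^sup>2) \<le> 1 / 2" using assms by (simp add: field_simps add_pos_nonneg)
  then have "2 * (1 - 1 / 2) \<le> 2 * (1 - K\<^sup>2 / (x\<^sup>2 + K\<^sup>2))"
    by (intro mult_left_mono diff_left_mono) auto
  then have "1 \<le> 2 * (1 - K\<^sup>2 / (x\<^sup>2 + K\<^sup>2))" by (rule order_trans[rotated]) simp
  moreover have "1 - cutoff K x \<le> 1" using cutoff_bounds(1)[of K x] by simp
  ultimately show ?thesis by (rule order_trans[rotated])
qed

definition tail :: "real \<Rightarrow> complex \<Rightarrow> real" where
  "tail K u = 2 * (1 + K * Im u / card A)"

lemma emp_tail:
  assumes "K > 0" "n > 0" "A \<noteq> {}"
  shows "emp n (\<lambda>r. 1 - cutoff K r) \<le> tail K (stieltjes n (Complex 0 K))"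
proof -
  have c: "real n * real (card A) > 0" using assms finite_A by (simp add: card_gt_0_iff)
  have "emp n (\<lambda>r. 1 - cutoff K r) \<le> emp n (\<lambda>r. 2 * (1 - K\<^sup>2 / (r\<^sup>2 + K\<^sup>2)))"
    unfolding emp_def using c by (intro divide_right_mono sum_mono one_minus_cutoff_le assms) auto
  also have "\<dots> = 2 * (1 - (\<Sum>r\<in>scaled_roots n. K\<^sup>2 / (r\<^sup>2 + K\<^sup>2)) / (n * card A))"
    unfolding emp_def sum_distrib_left[symmetric] sum_subtractf
    using c scaled_roots[OF assms(2)] assms(2,3) finite_A by (simp add: diff_divide_distrib card_gt_0_iff)
  also have "(\<Sum>r\<in>scaled_roots n. K\<^sup>2 / (r\<^sup>2 + K\<^sup>2)) = - K * Im (log_deriv (scaled_roots n) (Complex 0 K))"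
    unfolding log_deriv_def Im_sum Im_inverse_diff_real sum_distrib_left
    by (intro sum.cong refl, simp only: cmod_power2) (simp add: power2_eq_square)
  also have "2 * (1 - \<dots> / (n * card A)) = tail K (stieltjes n (Complex 0 K))"
    by (simp add: tail_def stieltjes_def)
  finally show ?thesis .
qed

text \<open>With \<open>w = \<omega> z\<close> and \<open>u\<close> the sum of
  \<open>1/(w - \<alpha>)\<close>, one has that \<open>z u - card A\<close> is the sum of
  \<open>(z - w + \<alpha>)/(w - \<alpha>)\<close>. Numerators are bounded since
  \<open>|z - w| \<le> card A\<close>, and denominators are at least \<open>K\<close>; the real part
  at \<open>z = i K\<close> is the tail up to a factor.\<close>

lemma tail_bound:
  assumes "A \<noteq> {}" "K > 0"
  shows "tail K (2 * (Complex 0 K - \<omega> (Complex 0 K))) \<le> 2 * (\<Sum>\<alpha>\<in>A. card A + \<bar>\<alpha>\<bar>) / card A / K"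
proof -
  define z where "z = Complex 0 K"
  define w where "w = \<omega> z"
  define u where "u = 2 * (z - w)"
  have z: "Im z > 0" "Im z \<ge> 0" using assms by (simp_all add: z_def)
  have w: "w \<in> subord_dom" "subord w = z" using \<omega>[OF z(2)] by (simp_all add: w_def)
  have N: "real (card A) > 0" using assms finite_A by (simp add: card_gt_0_iff)
  \<comment> \<open>\<open>spread\<close> is nonnegative, so \<open>Im_subord\<close> gives
    \<open>Im z \<le> Im w\<close>.\<close>
  have "Im w * (1 - spread w) \<le> Im w * 1"
    using w(1) by (intro mult_left_mono) (auto simp: subord_dom_def spread_def intro!: sum_nonneg)
  then have Imw: "K \<le> Im w" using Im_subord[of w] w by (simp add: z_def)
  have dist: "K \<le> cmod (w - of_real \<alpha>)" for \<alpha>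
    using Imw abs_Im_le_cmod[of "w - of_real \<alpha>"] by simp
  have u: "u = (\<Sum>\<alpha>\<in>A. 1 / (w - of_real \<alpha>))" using w(2)[symmetric] by (simp add: u_def subord_def)
  have zw: "cmod (z - w) \<le> card A" using subord_near[OF w(1)] w(2) by simp
  have "z * u - card A = (\<Sum>\<alpha>\<in>A. (z - w + of_real \<alpha>) / (w - of_real \<alpha>))"
  proof -
    have "z * u - card A = (\<Sum>\<alpha>\<in>A. z * (1 / (w - of_real \<alpha>)) - 1)"
      by (simp add: u sum_distrib_left sum_subtractf)
    also have "\<dots> = (\<Sum>\<alpha>\<in>A. (z - w + of_real \<alpha>) / (w - of_real \<alpha>))"
    proof (rule sum.cong)
      fix \<alpha>
      have "w - of_real \<alpha> \<noteq> 0" using dist[of \<alpha>] assms by auto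
      then show "z * (1 / (w - of_real \<alpha>)) - 1 = (z - w + of_real \<alpha>) / (w - of_real \<alpha>)"
        by (simp add: field_simps)
    qed simp
    finally show ?thesis .
  qed
  also have "cmod \<dots> \<le> (\<Sum>\<alpha>\<in>A. (card A + \<bar>\<alpha>\<bar>) / K)"
  proof (rule sum_norm_le)
    fix \<alpha> assume "\<alpha> \<in> A"
    have "cmod (z - w + of_real \<alpha>) \<le> card A + \<bar>\<alpha>\<bar>"
      using norm_triangle_ineq[of "z - w" "of_real \<alpha>"] zw by simp
    then show "cmod ((z - w + of_real \<alpha>) / (w - of_real \<alpha>)) \<le> (card A + \<bar>\<alpha>\<bar>) / K"
      unfolding norm_divide using dist assms by (intro frac_le) auto
  qed
  finally have "cmod (z * u - card A) \<le> (\<Sum>\<alpha>\<in>A. card A + \<bar>\<alpha>\<bar>) / K"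
    by (simp add: sum_divide_distrib)
  then have "\<bar>Re (z * u - card A)\<bar> \<le> (\<Sum>\<alpha>\<in>A. card A + \<bar>\<alpha>\<bar>) / K"
    using abs_Re_le_cmod order_trans by blast
  moreover have "Re (z * u - card A) = - (K * Im u + card A)" by (simp add: z_def)
  ultimately have "K * Im u + card A \<le> (\<Sum>\<alpha>\<in>A. card A + \<bar>\<alpha>\<bar>) / K" by linarith
  then have "(K * Im u + card A) * (2 / card A) \<le> (\<Sum>\<alpha>\<in>A. card A + \<bar>\<alpha>\<bar>) / K * (2 / card A)"
    using N by (intro mult_right_mono) auto
  moreover have "(K * Im u + card A) * (2 / card A) = tail K u" using N by (simp add: tail_def field_simps)
  ultimately have "tail K u \<le> 2 * (\<Sum>\<alpha>\<in>A. card A + \<bar>\<alpha>\<bar>) / card A / K" by (simp add: field_simps)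
  then show ?thesis by (simp only: u_def w_def z_def)
qed

lemma tail_tendsto:
  assumes "K > 0"
  shows "(\<lambda>n. tail K (stieltjes n (Complex 0 K))) \<longlonglongrightarrow> tail K (2 * (Complex 0 K - \<omega> (Complex 0 K)))"
proof -
  have "(\<lambda>n. 2 * (1 + K * Im (stieltjes n (Complex 0 K)) * (1 / card A))) \<longlonglongrightarrow>
      2 * (1 + K * Im (2 * (Complex 0 K - \<omega> (Complex 0 K))) * (1 / card A))"
    by (intro tendsto_intros stieltjes_limit(2)) (use assms in simp)
  then show ?thesis by (simp add: tail_def)
qed

lemma tail_small:
  assumes "A \<noteq> {}" "\<eta> > 0"
  obtains K where "K > 0" "K \<ge> b" "\<forall>\<^sub>F n in sequentially. emp n (\<lambda>r. 1 - cutoff K r) \<le> \<eta>"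
proof -
  define C where "C = 2 * (\<Sum>\<alpha>\<in>A. card A + \<bar>\<alpha>\<bar>) / card A"
  have "((\<lambda>K. C / K) \<longlongrightarrow> 0) at_top" by real_asymp
  then have "\<forall>\<^sub>F K in at_top. C / K < \<eta>" using assms by (intro order_tendstoD) auto
  with eventually_gt_at_top[of 0] eventually_ge_at_top[of b]
  have "\<forall>\<^sub>F K in at_top. K > 0 \<and> K \<ge> b \<and> C / K < \<eta>" by eventually_elim simp
  then obtain K where K: "K > 0" "K \<ge> b" "C / K < \<eta>"
    using eventually_happens'[OF trivial_limit_at_top_linorder] by blast
  have "tail K (2 * (Complex 0 K - \<omega> (Complex 0 K))) < \<eta>"
    using tail_bound[OF assms(1) K(1)] K(3) by (simp add: C_def)
  then have "\<forall>\<^sub>F n in sequentially. tail K (stieltjes n (Complex 0 K)) < \<eta>"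
    by (rule order_tendstoD(2)[OF tail_tendsto[OF K(1)]])
  with eventually_gt_at_top[of 0] have "\<forall>\<^sub>F n in sequentially. emp n (\<lambda>r. 1 - cutoff K r) \<le> \<eta>"
  proof eventually_elim
    case (elim n)
    from emp_tail[OF K(1) elim(1) assms(1)] elim(2) show ?case by linarith
  qed
  with K that show ?thesis by blast
qed

lemma emp_one: "n > 0 \<Longrightarrow> A \<noteq> {} \<Longrightarrow> emp n (\<lambda>_. 1) = 1"
  using scaled_roots[of n] finite_A by (simp add: emp_def)

lemma emp_cutoff_diff:
  assumes "\<And>x. \<bar>f x\<bar> \<le> B"
  shows "\<bar>emp n f - emp n (\<lambda>x. f x * cutoff K x)\<bar> \<le> B * emp n (\<lambda>r. 1 - cutoff K r)"
proof -
  have "emp n f - emp n (\<lambda>x. f x * cutoff K x) = (\<Sum>r\<in>scaled_roots n. f r * (1 - cutoff K r)) / (n * card A)"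
    unfolding emp_diff[symmetric] by (simp add: emp_def algebra_simps)
  also have "\<bar>\<dots>\<bar> = \<bar>\<Sum>r\<in>scaled_roots n. f r * (1 - cutoff K r)\<bar> / (n * card A)"
    by simp
  also have "\<dots> \<le> (\<Sum>r\<in>scaled_roots n. B * (1 - cutoff K r)) / (n * card A)"
  proof (rule divide_right_mono)
    have "\<bar>\<Sum>r\<in>scaled_roots n. f r * (1 - cutoff K r)\<bar> \<le> (\<Sum>r\<in>scaled_roots n. \<bar>f r * (1 - cutoff K r)\<bar>)"
      by (rule sum_abs)
    also have "\<dots> \<le> (\<Sum>r\<in>scaled_roots n. B * (1 - cutoff K r))"
      using cutoff_bounds by (intro sum_mono) (auto simp: abs_mult intro!: mult_right_mono assms)
    finally show "\<bar>\<Sum>r\<in>scaled_roots n. f r * (1 - cutoff K r)\<bar> \<le> (\<Sum>r\<in>scaled_roots n. B * (1 - cutoff K r))" .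
  qed simp
  also have "\<dots> = B * emp n (\<lambda>r. 1 - cutoff K r)"
    by (simp add: emp_def sum_distrib_left)
  finally show ?thesis .
qed

lemma integrable_limit_density:
  assumes "\<And>x. \<bar>x\<bar> > b \<Longrightarrow> limit_density x = 0"
  shows "integrable lborel limit_density"
  by (rule integrable_compact_support[OF continuous_on_limit_density assms])

text \<open>Multiply \<open>f\<close> by a cutoff with \<open>K \<ge> b\<close>: the limiting
  integral is unchanged, and by tightness the averages over the zeros change by little.\<close>

lemma emp_tendsto:
  assumes v: "\<And>x. \<bar>x\<bar> > b \<Longrightarrow> limit_density x = 0" and A: "A \<noteq> {}"
    and f: "continuous_on UNIV f" "\<And>x. \<bar>f x\<bar> \<le> B"
  shows "(\<lambda>n. emp n f) \<longlonglongrightarrow> (\<integral>x. f x * limit_density x \<partial>lborel)"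
proof (rule LIMSEQ_I)
  fix \<eta> :: real assume \<eta>: "\<eta> > 0"
  have B: "B \<ge> 0" using f(2)[of 0] by linarith
  \<comment> \<open>Using \<open>B + 1\<close> keeps the denominator positive when
    \<open>B = 0\<close>.\<close>
  have "\<eta> / (2 * (B + 1)) > 0" using \<eta> B by simp
  then obtain K where K: "K > 0" "K \<ge> b" "\<forall>\<^sub>F n in sequentially. emp n (\<lambda>r. 1 - cutoff K r) \<le> \<eta> / (2 * (B + 1))"
    using tail_small[OF A] by blast
  have eq: "f x * cutoff K x * limit_density x = f x * limit_density x" for x
    using v[of x] K(2) cutoff_bounds(3)[of x K] by (cases "\<bar>x\<bar> > b") auto
  have "(\<lambda>n. emp n (\<lambda>x. f x * cutoff K x)) \<longlonglongrightarrow> (\<integral>x. f x * cutoff K x * limit_density x \<partial>lborel)"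
    by (rule emp_tendsto_compact_support[where K = "K + 1"])
      (auto intro!: continuous_intros f continuous_on_cutoff simp: cutoff_bounds)
  then have "(\<lambda>n. emp n (\<lambda>x. f x * cutoff K x)) \<longlonglongrightarrow> (\<integral>x. f x * limit_density x \<partial>lborel)"
    unfolding eq .
  then have "\<forall>\<^sub>F n in sequentially. dist (emp n (\<lambda>x. f x * cutoff K x)) (\<integral>x. f x * limit_density x \<partial>lborel) < \<eta> / 2"
    by (rule tendstoD) (use \<eta> in simp)
  with K(3) have "\<forall>\<^sub>F n in sequentially. norm (emp n f - (\<integral>x. f x * limit_density x \<partial>lborel)) < \<eta>"
  proof eventually_elim
    case (elim n)
    have "B * emp n (\<lambda>r. 1 - cutoff K r) \<le> B * (\<eta> / (2 * (B + 1)))"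
      using elim B by (intro mult_left_mono)
    also have "\<dots> \<le> \<eta> / 2" using B \<eta> by (simp add: field_simps)
    finally have "B * emp n (\<lambda>r. 1 - cutoff K r) \<le> \<eta> / 2" .
    moreover have "\<bar>emp n f - emp n (\<lambda>x. f x * cutoff K x)\<bar> \<le> B * emp n (\<lambda>r. 1 - cutoff K r)"
      by (rule emp_cutoff_diff) (rule f(2))
    ultimately show ?case
      using elim(2) unfolding dist_real_def real_norm_def by linarith
  qed
  then show "\<exists>no. \<forall>n\<ge>no. norm (emp n f - (\<integral>x. f x * limit_density x \<partial>lborel)) < \<eta>"
    by (simp add: eventually_sequentially)
qed

text \<open>Tightness allows the constant test function 1, whose averages are all 1 for
  \<open>n > 0\<close>, so no mass is lost.\<close>

lemma limit_density_integral:
  assumes v: "\<And>x. \<bar>x\<bar> > b \<Longrightarrow> limit_density x = 0" and A: "A \<noteq> {}"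
  shows "(\<integral>x. limit_density x \<partial>lborel) = 1"
proof -
  have "(\<lambda>n. emp n (\<lambda>_. 1)) \<longlonglongrightarrow> (\<integral>x. 1 * limit_density x \<partial>lborel)"
    by (rule emp_tendsto[OF v A, where B = 1]) auto
  moreover have "(\<lambda>n. emp n (\<lambda>_. 1)) \<longlonglongrightarrow> 1"
    by (intro tendsto_eventually eventually_mono[OF eventually_gt_at_top[of 0]]) (simp add: emp_one A)
  ultimately show ?thesis using LIMSEQ_unique by force
qed

lemma prob_density_limit_density:
  assumes "\<And>x. \<bar>x\<bar> > b \<Longrightarrow> limit_density x = 0" "A \<noteq> {}"
  shows "prob_density limit_density"
  using integrable_limit_density[OF assms(1)] limit_density_integral[OF assms]
  by (auto simp: prob_density_def limit_density_nonneg has_bochner_integral_iff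
      intro: borel_measurable_continuous_onI continuous_on_limit_density)

end

section \<open>Support of the limiting density\<close>

text \<open>For open \<open>U\<close> the set of points of \<open>U\<close> with
  \<open>v x \<noteq> 0\<close> is open, and an open null set is empty. So \<open>U\<close> has
  positive measure exactly if it meets the nonvanishing set.\<close>

lemma density_support_continuous:
  assumes c: "continuous_on UNIV v" and nn: "\<And>x. 0 \<le> v x"
  shows "density_support v = closure {x. v x \<noteq> 0}"
proof -
  have vm [measurable]: "v \<in> borel_measurable borel" by (rule borel_measurable_continuous_onI[OF c])
  have pos: "emeasure (density lborel (\<lambda>x. ennreal (v x))) U > 0 \<longleftrightarrow> U \<inter> {x. v x \<noteq> 0} \<noteq> {}" if U: "open U" for U
  proof -
    have [measurable]: "U \<in> sets borel" using U by simp
    have op: "open (U \<inter> {x. v x \<noteq> 0})"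
      using U c by (intro open_Int open_Collect_neq) (auto simp: continuous_on_eq_continuous_at)
    have "emeasure (density lborel (\<lambda>x. ennreal (v x))) U = 0 \<longleftrightarrow>
        (AE x in lborel. ennreal (v x) * indicator U x = 0)"
      by (simp add: emeasure_density nn_integral_0_iff_AE)
    also have "\<dots> \<longleftrightarrow> (AE x in lborel. x \<notin> U \<inter> {x. v x \<noteq> 0})"
      by (intro AE_cong) (auto simp: indicator_def ennreal_eq_0_iff nn antisym)
    also have "\<dots> \<longleftrightarrow> U \<inter> {x. v x \<noteq> 0} \<in> null_sets lborel"
      by (subst AE_iff_null_sets) (use op in auto)
    also have "\<dots> \<longleftrightarrow> U \<inter> {x. v x \<noteq> 0} = {}"
      using open_not_negligible[OF op] by (auto simp: negligible_iff_null_sets intro: null_sets_completionI)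
    finally show ?thesis by (auto simp: zero_less_iff_neq_zero)
  qed
  have "x \<in> closure S \<longleftrightarrow> (\<forall>U. open U \<longrightarrow> x \<in> U \<longrightarrow> U \<inter> S \<noteq> {})" for x :: real and S
  proof
    assume "x \<in> closure S"
    then show "\<forall>U. open U \<longrightarrow> x \<in> U \<longrightarrow> U \<inter> S \<noteq> {}"
      using open_Int_closure_eq_empty[of _ S] by blast
  next
    assume "\<forall>U. open U \<longrightarrow> x \<in> U \<longrightarrow> U \<inter> S \<noteq> {}"
    moreover have "- closure S \<inter> S = {}" using closure_subset[of S] by blast
    ultimately show "x \<in> closure S" by (metis ComplI closed_closure open_Compl)
  qed
  with pos show ?thesis
    unfolding density_support_def measure_support_def by (auto simp del: disjoint_iff)
qed

context sources
begin

text \<open>The difference quotient of \<open>subord\<close> is nonnegative by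
  \<open>subord_dom_cross_bound\<close>; injectivity makes the monotonicity strict, even across
  sources.\<close>

lemma subord_mono_real:
  assumes "complex_of_real s \<in> subord_dom" "complex_of_real t \<in> subord_dom" "s < t"
  shows "Re (subord s) < Re (subord t)"
proof -
  define F where "F = 1 - Re ((\<Sum>\<alpha>\<in>A. 1 / ((complex_of_real s - of_real \<alpha>) * (complex_of_real t - of_real \<alpha>))) / 2)"
  have "0 \<le> (\<Sum>\<alpha>\<in>A. (cmod (1 / (complex_of_real s - of_real \<alpha>) - cnj (1 / (complex_of_real t - of_real \<alpha>))))\<^sup>2)"
    by (intro sum_nonneg) auto
  also have "\<dots> \<le> 4 * F" unfolding F_def by (rule subord_dom_cross_bound[OF assms(1,2)])
  finally have F: "F \<ge> 0" by simp
  have "subord s - subord t = of_real (s - t) *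
      (1 - (\<Sum>\<alpha>\<in>A. 1 / ((complex_of_real s - of_real \<alpha>) * (complex_of_real t - of_real \<alpha>))) / 2)"
    using subord_diff[of s t] assms by (simp add: subord_dom_def)
  then have "Re (subord s - subord t) = (s - t) * F" by (simp only: Re_complex_of_real Im_complex_of_real times_complex.sel F_def) simp
  then have "Re (subord s) \<le> Re (subord t)"
    using mult_nonpos_nonneg[of "s - t" F] F assms(3) by simp
  moreover have "Re (subord s) \<noteq> Re (subord t)"
  proof
    assume "Re (subord s) = Re (subord t)"
    then have "subord s = subord t" by (simp add: complex_eq_iff Im_subord)
    then show False using inj_onD[OF subord_inj] assms by fastforce
  qed
  ultimately show ?thesis by simp
qed

text \<open>The density vanishes at \<open>x\<close> exactly if \<omega> takes a real value there,
  and \<omega> inverts \<open>subord\<close>.\<close>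

lemma limit_density_eq_0_iff:
  assumes "A \<noteq> {}"
  shows "limit_density x = 0 \<longleftrightarrow> (\<exists>t. complex_of_real t \<in> subord_dom \<and> x = Re (subord t))"
proof
  assume "limit_density x = 0"
  then have "Im (\<omega> (of_real x)) = 0" using assms finite_A by (auto simp: limit_density_def)
  then have "\<omega> (of_real x) = of_real (Re (\<omega> (of_real x)))" by (simp add: complex_eq_iff)
  moreover have "\<omega> (of_real x) \<in> subord_dom" "subord (\<omega> (of_real x)) = of_real x" by (rule \<omega>; simp)+
  ultimately show "\<exists>t. complex_of_real t \<in> subord_dom \<and> x = Re (subord t)"
    by (intro exI[of _ "Re (\<omega> (of_real x))"]) (metis Re_complex_of_real)
next
  assume "\<exists>t. complex_of_real t \<in> subord_dom \<and> x = Re (subord t)"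
  then obtain t where t: "complex_of_real t \<in> subord_dom" "x = Re (subord t)" by blast
  then have "of_real x = subord t" by (simp add: complex_eq_iff Im_subord)
  then have "\<omega> (of_real x) = of_real t" using \<omega>_subord[OF t(1)] by simp
  then show "limit_density x = 0" by (simp add: limit_density_def)
qed

end

section \<open>The constant of the phase transition\<close>

definition gap_fun :: "real \<Rightarrow> real" where
  "gap_fun s = 1 / s\<^sup>2 + 1 / (1 - s)\<^sup>2 + 1 / (1 + s)\<^sup>2"

text \<open>An infimum suffices: strict comparisons with \<open>2 a\<^sup>2\<close> and the
  numerical bounds do not ask where, or whether, it is attained.\<close>

definition gap_min :: real where
  "gap_min = Inf (gap_fun ` {0<..<1})"

lemma bdd_below_gap_fun: "bdd_below (gap_fun ` {0<..<1})"
  by (rule bdd_belowI[of _ 0]) (auto simp: gap_fun_def)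

lemma gap_min_le: "0 < s \<Longrightarrow> s < 1 \<Longrightarrow> gap_min \<le> gap_fun s"
  unfolding gap_min_def by (rule cInf_lower) (auto intro: bdd_below_gap_fun)

lemma gap_min_less: "gap_min < y \<Longrightarrow> \<exists>s. 0 < s \<and> s < 1 \<and> gap_fun s < y"
  unfolding gap_min_def
  using cInf_less_iff[OF _ bdd_below_gap_fun, of y] by auto

text \<open>The convex function \<open>1/x\<^sup>2\<close> lies above its tangent at
  \<open>y\<close>; the difference is an explicit nonnegative fraction.\<close>

lemma inverse_square_tangent:
  fixes x y :: real
  assumes "x > 0" "y > 0"
  shows "1 / y\<^sup>2 - 2 / y ^ 3 * (x - y) \<le> 1 / x\<^sup>2"
proof -
  have "1 / x\<^sup>2 - (1 / y\<^sup>2 - 2 / y ^ 3 * (x - y)) = (x - y)\<^sup>2 * (2 * x + y) / (x\<^sup>2 * y ^ 3)"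
    using assms by (simp add: divide_simps) (simp add: eval_nat_numeral algebra_simps)
  moreover have "\<dots> \<ge> 0" using assms by auto
  ultimately show ?thesis by linarith
qed

lemma gap_fun_tangent:
  assumes "0 < s" "s < 1" "0 < r" "r < 1"
  shows "gap_fun r + (2 / (1 - r) ^ 3 - 2 / r ^ 3 - 2 / (1 + r) ^ 3) * (s - r) \<le> gap_fun s"
proof -
  have "X + Y + Z + (D - C - E) * (s - r) \<le> X' + Y' + Z'"
    if "X - C * (s - r) \<le> X'" "Y - D * ((1 - s) - (1 - r)) \<le> Y'" "Z - E * ((1 + s) - (1 + r)) \<le> Z'"
    for X Y Z X' Y' Z' C D E :: real
    using that by (simp add: algebra_simps)
  then show ?thesis
    unfolding gap_fun_def
    using inverse_square_tangent[of s r] inverse_square_tangent[of "1 - s" "1 - r"]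
      inverse_square_tangent[of "1 + s" "1 + r"] assms by simp
qed

text \<open>The bounds say that \<open>sqrt (2 * gap_min)\<close> is within \<open>5 / 10^9\<close>
  of 4.10938818. The upper one evaluates \<open>gap_fun\<close> at one point. For the lower one,
  convexity keeps \<open>gap_fun\<close> above its tangent there, which drops by at most its
  absolute slope on an interval of length 1.\<close>

lemma gap_min_bounds:
  "4.109388175\<^sup>2 / 2 \<le> gap_min" "gap_min \<le> 4.109388185\<^sup>2 / 2"
proof -
  \<comment> \<open>numerical approximation of the minimiser; the tangent at \<open>r\<close> is nearly horizontal\<close>
  define r :: real where "r = 0.50306717895"
  define D where "D = 2 / (1 - r) ^ 3 - 2 / r ^ 3 - 2 / (1 + r) ^ 3"
  have D: "\<bar>D\<bar> \<le> 1 / 10 ^ 8" unfolding D_def r_def by (simp add: abs_le_iff field_simps)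
  have r: "0 < r" "r < 1" by (auto simp: r_def)
  show "4.109388175\<^sup>2 / 2 \<le> gap_min"
    unfolding gap_min_def
  proof (rule cInf_greatest)
    fix y assume "y \<in> gap_fun ` {0<..<1}"
    then obtain s where s: "0 < s" "s < 1" "y = gap_fun s" by auto
    have "\<bar>s - r\<bar> \<le> 1" using s r by linarith
    then have "\<bar>D * (s - r)\<bar> \<le> 1 / 10 ^ 8 * 1"
      unfolding abs_mult using D by (intro mult_mono) auto
    then have "gap_fun r - 1 / 10 ^ 8 \<le> y"
      using gap_fun_tangent[OF s(1,2) r] s(3) unfolding D_def[symmetric] by linarith
    moreover have "4.109388175\<^sup>2 / 2 \<le> gap_fun r - 1 / 10 ^ 8"
      unfolding gap_fun_def r_def by (simp add: field_simps power2_eq_square)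
    ultimately show "4.109388175\<^sup>2 / 2 \<le> y" by linarith
  qed simp
  have "gap_min \<le> gap_fun r" by (rule gap_min_le[OF r])
  also have "\<dots> \<le> 4.109388185\<^sup>2 / 2"
    unfolding gap_fun_def r_def by (simp add: field_simps power2_eq_square)
  finally show "gap_min \<le> 4.109388185\<^sup>2 / 2" .
qed

section \<open>Three sources: the real part of the domain and its edges\<close>

locale three_sources =
  fixes a :: real
  assumes a_pos: "a > 0"
begin

sublocale sources "{-a, 0, a}"
  by standard simp

definition rsub :: "real \<Rightarrow> real" where
  "rsub x = x + (1 / (x + a) + 1 / x + 1 / (x - a)) / 2"

definition rspread :: "real \<Rightarrow> real" where
  "rspread x = (1 / (x + a)\<^sup>2 + 1 / x\<^sup>2 + 1 / (x - a)\<^sup>2) / 2"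

definition real_dom :: "real set" where
  "real_dom = {x. x \<notin> {-a, 0, a} \<and> rspread x \<le> 1}"

lemma card_A: "card {-a, 0, a} = 3"
  using a_pos by simp

lemma subord_of_real: "subord (of_real x) = of_real (rsub x)"
  using a_pos by (simp add: subord_def rsub_def)

lemma spread_of_real: "spread (of_real x) = rspread x"
proof -
  have "(cmod (complex_of_real x - of_real \<alpha>))\<^sup>2 = (x - \<alpha>)\<^sup>2" for \<alpha>
    by (simp flip: of_real_diff)
  then have "spread (of_real x) = (\<Sum>\<alpha>\<in>{-a, 0, a}. 1 / (x - \<alpha>)\<^sup>2) / 2"
    by (simp only: spread_def)
  then show ?thesis using a_pos by (simp add: rspread_def)
qed

lemma of_real_dom_iff: "complex_of_real x \<in> subord_dom \<longleftrightarrow> x \<in> real_dom"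
  by (auto simp: subord_dom_def real_dom_def spread_of_real simp flip: of_real_minus)

lemma rsub_strict_mono: "s \<in> real_dom \<Longrightarrow> t \<in> real_dom \<Longrightarrow> s < t \<Longrightarrow> rsub s < rsub t"
  using subord_mono_real[of s t] by (simp add: of_real_dom_iff subord_of_real)

lemma limit_density_0: "limit_density x = 0 \<longleftrightarrow> x \<in> rsub ` real_dom"
  using limit_density_eq_0_iff[of x] by (auto simp: of_real_dom_iff subord_of_real)

lemma rsub_minus: "rsub (- x) = - rsub x"
proof -
  have "- x + a = - (x - a)" "- x - a = - (x + a)" by simp_all
  then have "1 / (- x + a) = - (1 / (x - a))" "1 / (- x - a) = - (1 / (x + a))" "1 / (- x) = - (1 / x)"
    by (simp_all only: minus_divide_right)
  moreover have "- x + (- P + - Q + - R) / 2 = - (x + (R + Q + P) / 2)" for P Q R :: real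
    by (simp add: field_simps)
  ultimately show ?thesis by (simp only: rsub_def)
qed

lemma rspread_minus: "rspread (- x) = rspread x"
proof -
  have "(- x + a)\<^sup>2 = (x - a)\<^sup>2" "(- x - a)\<^sup>2 = (x + a)\<^sup>2" by (simp_all add: power2_eq_square algebra_simps)
  then show ?thesis by (simp add: rspread_def)
qed

lemma real_dom_minus: "- x \<in> real_dom \<longleftrightarrow> x \<in> real_dom"
  by (auto simp: real_dom_def rspread_minus)

lemma continuous_on_rspread: "{-a, 0, a} \<inter> S = {} \<Longrightarrow> continuous_on S rspread"
  unfolding rspread_def by (intro continuous_intros) (auto simp: add_eq_0_iff2)

lemma continuous_on_rsub: "{-a, 0, a} \<inter> S = {} \<Longrightarrow> continuous_on S rsub"
  unfolding rsub_def by (intro continuous_intros) (auto simp: add_eq_0_iff2)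

lemma rspread_gap_fun:
  assumes "0 < x" "x < a"
  shows "rspread x = gap_fun (x / a) / (2 * a\<^sup>2)"
proof -
  have eq: "1 - x / a = (a - x) / a" "1 + x / a = (x + a) / a" using assms by (simp_all add: field_simps)
  show ?thesis
    unfolding gap_fun_def rspread_def eq power_divide power2_commute[of a x]
    using assms by (simp add: add_divide_distrib)
qed

text \<open>\<open>rspread\<close> is strictly decreasing to the right of \<open>a\<close>, so it
  crosses 1 once.\<close>

lemma outer_edge:
  obtains \<beta> where "\<beta> > a" "\<And>t. t > a \<Longrightarrow> t \<in> real_dom \<longleftrightarrow> \<beta> \<le> t"
proof -
  have dec: "rspread y < rspread x" if "a < x" "x < y" for x y
  proof -
    have "1 / (y + a)\<^sup>2 < 1 / (x + a)\<^sup>2" "1 / y\<^sup>2 < 1 / x\<^sup>2" "1 / (y - a)\<^sup>2 < 1 / (x - a)\<^sup>2"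
      using that a_pos by (auto intro!: divide_strict_left_mono power_strict_mono mult_pos_pos zero_less_power)
    then show ?thesis by (simp add: rspread_def)
  qed
  \<comment> \<open>At \<open>a + 1/2\<close> the term of the source \<open>a\<close> alone
    contributes 2; at \<open>a + 3\<close> all three terms are at most 1/9 before halving.\<close>
  have "rspread (a + 1 / 2) \<ge> 1"
    using a_pos by (simp add: rspread_def power2_eq_square field_simps)
  moreover have "rspread (a + 3) \<le> 1"
  proof -
    have "1 / (a + 3 + a)\<^sup>2 \<le> 1 / 3\<^sup>2" "1 / (a + 3)\<^sup>2 \<le> 1 / 3\<^sup>2"
      using a_pos by (intro divide_left_mono power_mono mult_pos_pos zero_less_power; simp)+
    then show ?thesis by (simp add: rspread_def)
  qed
  moreover have "continuous_on {a + 1 / 2..a + 3} rspread"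
    by (rule continuous_on_rspread) (use a_pos in auto)
  ultimately obtain \<beta> where \<beta>: "a + 1 / 2 \<le> \<beta>" "rspread \<beta> = 1"
    using IVT2'[of rspread "a + 3" 1 "a + 1 / 2"] by auto
  show ?thesis
  proof (rule that)
    fix t assume t: "t > a"
    have "rspread t \<le> 1 \<longleftrightarrow> \<beta> \<le> t"
      using dec[of t \<beta>] dec[of \<beta> t] t \<beta> by (cases t \<beta> rule: linorder_cases) auto
    then show "t \<in> real_dom \<longleftrightarrow> \<beta> \<le> t" using t a_pos by (auto simp: real_dom_def)
  qed (use \<beta> in simp)
qed

text \<open>On \<open>(0, a)\<close> the function \<open>rspread\<close> is convex, is below 1 at
  \<open>s\<close>, and is at least 1 near both ends. So its sublevel set is an interval, with edges
  given by the intermediate value theorem.\<close>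

lemma inner_edges:
  assumes s: "0 < s" "s < a" "rspread s < 1"
  obtains p q where "0 < p" "p < q" "q < a" "\<And>t. 0 < t \<Longrightarrow> t < a \<Longrightarrow> t \<in> real_dom \<longleftrightarrow> p \<le> t \<and> t \<le> q"
proof -
  have conv: "rspread ((1 - l) * x + l * y) \<le> (1 - l) * rspread x + l * rspread y"
    if "0 < x" "x < a" "0 < y" "y < a" "0 \<le> l" "l \<le> 1" for x y l
  proof -
    define r where "r = (1 - l) * x + l * y"
    have r: "0 < r" "r < a"
    proof -
      have "convex {0<..<a}" by simp
      from convexD[OF this, of x y "1 - l" l] that show "0 < r" "r < a" by (auto simp: r_def)
    qed
    define D where "D = (2 / (1 - r / a) ^ 3 - 2 / (r / a) ^ 3 - 2 / (1 + r / a) ^ 3)"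
    have t: "gap_fun (r / a) + D * (z / a - r / a) \<le> gap_fun (z / a)" if "0 < z" "z < a" for z
      unfolding D_def using that r by (intro gap_fun_tangent) auto
    \<comment> \<open>Averaging the tangent at \<open>r\<close> over the two endpoints returns its
      value at \<open>r\<close>, which is their weighted mean.\<close>
    have "(1 - l) * (gap_fun (r / a) + D * (x / a - r / a)) + l * (gap_fun (r / a) + D * (y / a - r / a)) \<le>
        (1 - l) * gap_fun (x / a) + l * gap_fun (y / a)"
      using that by (intro add_mono mult_left_mono t) auto
    moreover have "(1 - l) * (gap_fun (r / a) + D * (x / a - r / a)) + l * (gap_fun (r / a) + D * (y / a - r / a)) =
        gap_fun (r / a) + D * (((1 - l) * x + l * y) - r) / a"
      using a_pos by (simp add: field_simps)
    ultimately have "gap_fun (r / a) \<le> (1 - l) * gap_fun (x / a) + l * gap_fun (y / a)"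
      by (simp add: r_def)
    then have "gap_fun (r / a) / (2 * a\<^sup>2) \<le> ((1 - l) * gap_fun (x / a) + l * gap_fun (y / a)) / (2 * a\<^sup>2)"
      by (rule divide_right_mono) simp
    then show ?thesis
      using that r by (simp add: rspread_gap_fun add_divide_distrib flip: r_def)
  qed
  have between: "rspread m < 1"
    if "0 < u" "u < a" "rspread u \<le> 1" "u < m \<and> m < s \<or> s < m \<and> m < u" for u m
  proof -
    define l where "l = (m - u) / (s - u)"
    have ne: "s - u \<noteq> 0" using that by auto
    have l: "0 < l" "l < 1"
      using that by (auto simp: l_def divide_simps)
    have m: "m = (1 - l) * u + l * s"
    proof -
      have "l * (s - u) = m - u" using ne by (simp add: l_def)
      then show ?thesis by (simp add: algebra_simps)
    qed
    have "rspread m \<le> (1 - l) * rspread u + l * rspread s"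
      unfolding m using that s l by (intro conv) auto
    also have "\<dots> < (1 - l) * 1 + l * 1"
      using l that s by (intro add_le_less_mono mult_left_mono mult_strict_left_mono) auto
    finally show ?thesis by simp
  qed
  \<comment> \<open>Within 1/2 of 0 or \<open>a\<close> a single summand is at least 4.\<close>
  have small: "rspread x \<ge> 1" if "0 < x" "x < a" "x \<le> 1 / 2 \<or> a - x \<le> 1 / 2" for x
  proof -
    have *: "1 / y\<^sup>2 \<ge> 4" if "0 < y" "y \<le> 1 / 2" for y :: real
    proof -
      have "y\<^sup>2 \<le> (1 / 2)\<^sup>2" using that by (intro power_mono) auto
      then show ?thesis using that by (simp add: field_simps power2_eq_square)
    qed
    have "1 / x\<^sup>2 \<ge> 4 \<or> 1 / (x - a)\<^sup>2 \<ge> 4"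
      using *[of x] *[of "a - x"] that by (auto simp: power2_commute[of x a])
    moreover have "1 / x\<^sup>2 \<ge> 0" "1 / (x - a)\<^sup>2 \<ge> 0" "1 / (x + a)\<^sup>2 \<ge> 0" by auto
    moreover have "4 \<le> P \<or> 4 \<le> R \<Longrightarrow> 0 \<le> P \<Longrightarrow> 0 \<le> R \<Longrightarrow> 0 \<le> Q \<Longrightarrow> 1 \<le> (Q + P + R) / 2" for P Q R :: real
      by auto
    ultimately show ?thesis unfolding rspread_def by blast
  qed
  define x0 where "x0 = min s (1 / 2)"
  define x1 where "x1 = max s (a - 1 / 2)"
  have x0: "0 < x0" "x0 \<le> s" "rspread x0 \<ge> 1"
    using small[of x0] s by (auto simp: x0_def min_def split: if_splits)
  have x1: "x1 < a" "s \<le> x1" "rspread x1 \<ge> 1"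
    using small[of x1] s by (auto simp: x1_def max_def split: if_splits)
  have "continuous_on {x0..s} rspread"
    by (rule continuous_on_rspread) (use a_pos x0 s in auto)
  then obtain p where p: "x0 \<le> p" "p \<le> s" "rspread p = 1"
    using IVT2'[of rspread s 1 x0] x0 s by auto
  have "continuous_on {s..x1} rspread"
    by (rule continuous_on_rspread) (use a_pos x1 s in auto)
  then obtain q where q: "s \<le> q" "q \<le> x1" "rspread q = 1"
    using IVT'[of rspread s 1 x1] x1 s by auto
  have ps: "p < s" using p s by (cases "p = s") auto
  have sq: "s < q" using q s by (cases "q = s") auto
  show ?thesis
  proof (rule that[of p q])
    fix t assume t: "0 < t" "t < a"
    have "rspread t \<le> 1 \<longleftrightarrow> p \<le> t \<and> t \<le> q"
    proof
      assume "rspread t \<le> 1"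
      then show "p \<le> t \<and> t \<le> q"
        using between[of t p] between[of t q] t p q ps sq by force
    next
      assume "p \<le> t \<and> t \<le> q"
      then show "rspread t \<le> 1"
        using between[of p t] between[of q t] t p q ps sq x0 x1 s by (cases t s rule: linorder_cases) force+
    qed
    then show "t \<in> real_dom \<longleftrightarrow> p \<le> t \<and> t \<le> q" using t by (auto simp: real_dom_def)
  qed (use x0 x1 p q ps sq in auto)
qed

text \<open>\<open>rsub\<close> is increasing on the domain and satisfies
  \<open>t \<le> rsub t\<close> to the right of \<open>a\<close>, so it is unbounded and the
  intermediate value theorem fills the half-line.\<close>

lemma rsub_image_atLeast:
  assumes "\<beta> > a" "\<And>t. t > a \<Longrightarrow> t \<in> real_dom \<longleftrightarrow> \<beta> \<le> t"
  shows "rsub ` {\<beta>..} = {rsub \<beta>..}" "rsub \<beta> > 0"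
proof -
  have ge: "t \<le> rsub t" if "t > a" for t
    using that a_pos by (simp add: rsub_def)
  then show "rsub \<beta> > 0" using assms(1) a_pos by (meson less_le_trans less_trans)
  show "rsub ` {\<beta>..} = {rsub \<beta>..}"
  proof safe
    fix t assume "\<beta> \<le> t"
    then show "rsub \<beta> \<le> rsub t"
      using rsub_strict_mono[of \<beta> t] assms by (cases "t = \<beta>") auto
  next
    fix y assume y: "rsub \<beta> \<le> y"
    have "continuous_on {\<beta>..max \<beta> y} rsub"
      by (rule continuous_on_rsub) (use assms a_pos in auto)
    moreover have "y \<le> rsub (max \<beta> y)" using ge[of "max \<beta> y"] assms by simp
    ultimately obtain t where "\<beta> \<le> t" "rsub t = y"
      using IVT'[of rsub \<beta> y "max \<beta> y"] y by auto
    then show "y \<in> rsub ` {\<beta>..}" by auto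
  qed
qed

lemma rsub_image_Icc:
  assumes "0 < p" "p \<le> q" "q < a" "{p..q} \<subseteq> real_dom"
  shows "rsub ` {p..q} = {rsub p..rsub q}"
proof safe
  fix t assume t: "t \<in> {p..q}"
  show "rsub t \<in> {rsub p..rsub q}"
    using rsub_strict_mono[of p t] rsub_strict_mono[of t q] assms t
    by (cases "t = p"; cases "t = q") (auto simp: subset_iff)
next
  fix y assume y: "y \<in> {rsub p..rsub q}"
  have "continuous_on {p..q} rsub"
    by (rule continuous_on_rsub) (use assms a_pos in auto)
  then obtain t where "p \<le> t" "t \<le> q" "rsub t = y"
    using IVT'[of rsub p y q] y assms by auto
  then show "y \<in> rsub ` {p..q}" by auto
qed

text \<open>\<open>rsub\<close> is odd and the domain is symmetric without 0, so the positive half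
  of the domain determines the zero set of the density.\<close>

lemma limit_density_0_cases:
  "limit_density x = 0 \<longleftrightarrow> x \<in> rsub ` (real_dom \<inter> {0<..}) \<or> - x \<in> rsub ` (real_dom \<inter> {0<..})"
proof -
  have "real_dom = (real_dom \<inter> {0<..}) \<union> uminus ` (real_dom \<inter> {0<..})"
  proof (intro equalityI subsetI)
    fix t assume t: "t \<in> real_dom"
    then have "t \<noteq> 0" by (auto simp: real_dom_def)
    then show "t \<in> (real_dom \<inter> {0<..}) \<union> uminus ` (real_dom \<inter> {0<..})"
      using t real_dom_minus[of t] by (cases "t > 0") (auto intro: image_eqI[of _ _ "- t"])
  qed (auto simp: real_dom_minus)
  then have "rsub ` real_dom = rsub ` (real_dom \<inter> {0<..}) \<union> uminus ` rsub ` (real_dom \<inter> {0<..})"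
    by (metis (no_types, lifting) image_Un image_comp image_cong o_apply rsub_minus)
  moreover have "x \<in> uminus ` S \<longleftrightarrow> - x \<in> S" for S :: "real set"
    by force
  ultimately show ?thesis by (simp add: limit_density_0)
qed

lemma limit_density_compact_support:
  obtains b where "b > 0" "\<And>x. \<bar>x\<bar> > b \<Longrightarrow> limit_density x = 0"
proof -
  obtain \<beta> where \<beta>: "\<beta> > a" "\<And>t. t > a \<Longrightarrow> t \<in> real_dom \<longleftrightarrow> \<beta> \<le> t"
    using outer_edge by blast
  have im: "rsub ` {\<beta>..} = {rsub \<beta>..}" "rsub \<beta> > 0"
    using rsub_image_atLeast \<beta> by blast+
  show ?thesis
  proof (rule that[OF im(2)])
    fix x assume "\<bar>x\<bar> > rsub \<beta>"
    then have "\<bar>x\<bar> \<in> rsub ` {\<beta>..}" unfolding im(1) by simp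
    then obtain t where "\<beta> \<le> t" "\<bar>x\<bar> = rsub t" by auto
    then show "limit_density x = 0"
      unfolding limit_density_0_cases using \<beta> a_pos
      by (auto simp: abs_if image_iff intro!: bexI[of _ t] split: if_splits)
  qed
qed

section \<open>The two shapes of the support\<close>

lemma density_support_limit_density: "density_support limit_density = closure {x. limit_density x \<noteq> 0}"
  by (rule density_support_continuous[OF continuous_on_limit_density limit_density_nonneg])

text \<open>Below the threshold \<open>rspread\<close> exceeds 1 on all of \<open>(0, a)\<close>, so
  the positive half of the domain is only the outer half-line.\<close>

lemma one_interval:
  assumes "2 * a\<^sup>2 < gap_min"
  shows "\<exists>b>0. density_support limit_density = {-b..b}"
proof -
  obtain \<beta> where \<beta>: "\<beta> > a" "\<And>t. t > a \<Longrightarrow> t \<in> real_dom \<longleftrightarrow> \<beta> \<le> t"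
    using outer_edge by blast
  have im: "rsub ` {\<beta>..} = {rsub \<beta>..}" "rsub \<beta> > 0"
    using rsub_image_atLeast \<beta> by blast+
  have inner: "t \<notin> real_dom" if "0 < t" "t < a" for t
  proof -
    have "2 * a\<^sup>2 < gap_fun (t / a)"
      using gap_min_le[of "t / a"] that assms by simp
    then have "rspread t > 1" using that a_pos by (simp add: rspread_gap_fun)
    then show ?thesis by (simp add: real_dom_def)
  qed
  have right: "t \<in> real_dom \<and> t > 0 \<longleftrightarrow> t \<ge> \<beta>" for t
    using inner[of t] \<beta> a_pos by (cases t a rule: linorder_cases) (auto simp: real_dom_def)
  have pos: "real_dom \<inter> {0<..} = {\<beta>..}"
    by (simp only: set_eq_iff Int_iff greaterThan_iff atLeast_iff right simp_thms)
  have iff: "limit_density x = 0 \<longleftrightarrow> rsub \<beta> \<le> x \<or> rsub \<beta> \<le> - x" for x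
    by (simp only: limit_density_0_cases pos im(1) atLeast_iff)
  have "{x. limit_density x \<noteq> 0} = {- rsub \<beta><..<rsub \<beta>}"
    by (simp only: iff set_eq_iff mem_Collect_eq greaterThanLessThan_iff) linarith
  then have "density_support limit_density = {- rsub \<beta>..rsub \<beta>}"
    using im(2) by (simp add: density_support_limit_density closure_greaterThanLessThan)
  then show ?thesis using im(2) by blast
qed

text \<open>Above the threshold \<open>(0, a)\<close> contributes an interval \<open>[p, q]\<close>
  of the domain; its image and the mirror image are the two gaps in the support.\<close>

lemma three_intervals:
  assumes "gap_min < 2 * a\<^sup>2"
  shows "\<exists>a' b d. 0 < d \<and> d < a' \<and> a' < b \<and> density_support limit_density = {-b..-a'} \<union> {-d..d} \<union> {a'..b}"
proof -
  obtain \<beta> where \<beta>: "\<beta> > a" "\<And>t. t > a \<Longrightarrow> t \<in> real_dom \<longleftrightarrow> \<beta> \<le> t"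
    using outer_edge by blast
  have im: "rsub ` {\<beta>..} = {rsub \<beta>..}" "rsub \<beta> > 0"
    using rsub_image_atLeast \<beta> by blast+
  obtain s where s: "0 < s" "s < 1" "gap_fun s < 2 * a\<^sup>2" using gap_min_less[OF assms] by blast
  have "rspread (a * s) < 1"
    using s a_pos by (subst rspread_gap_fun) auto
  then obtain p q where pq: "0 < p" "p < q" "q < a"
    "\<And>t. 0 < t \<Longrightarrow> t < a \<Longrightarrow> t \<in> real_dom \<longleftrightarrow> p \<le> t \<and> t \<le> q"
    using inner_edges[of "a * s"] s a_pos by auto
  have "{p..q} \<subseteq> real_dom" using pq by auto
  then have im': "rsub ` {p..q} = {rsub p..rsub q}"
    using pq by (intro rsub_image_Icc) auto
  \<comment> \<open>Including \<open>- p\<close> gives \<open>rsub (- p) < rsub p\<close>, which by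
    oddness is the positivity of \<open>rsub p\<close>.\<close>
  have "p \<in> real_dom" "q \<in> real_dom" "\<beta> \<in> real_dom" "- p \<in> real_dom"
    using pq \<beta> by (auto simp: real_dom_minus)
  then have order: "rsub (- p) < rsub p" "rsub p < rsub q" "rsub q < rsub \<beta>"
    using pq \<beta> by (auto intro!: rsub_strict_mono)
  have right: "t \<in> real_dom \<and> t > 0 \<longleftrightarrow> t \<ge> \<beta> \<or> p \<le> t \<and> t \<le> q" for t
    using pq \<beta> a_pos by (cases t a rule: linorder_cases; cases "t > 0") (auto simp: real_dom_def)
  have pos: "real_dom \<inter> {0<..} = {\<beta>..} \<union> {p..q}"
    by (simp only: set_eq_iff Int_iff Un_iff greaterThan_iff atLeast_iff atLeastAtMost_iff right simp_thms)
  have iff: "limit_density x = 0 \<longleftrightarrow>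
      (rsub \<beta> \<le> x \<or> rsub p \<le> x \<and> x \<le> rsub q) \<or> (rsub \<beta> \<le> - x \<or> rsub p \<le> - x \<and> - x \<le> rsub q)" for x
    by (simp only: limit_density_0_cases pos image_Un im(1) im' Un_iff atLeast_iff atLeastAtMost_iff)
  have "{x. limit_density x \<noteq> 0} =
      {- rsub \<beta><..<- rsub q} \<union> {- rsub p<..<rsub p} \<union> {rsub q<..<rsub \<beta>}"
    using order unfolding rsub_minus
    by (simp only: iff set_eq_iff mem_Collect_eq Un_iff greaterThanLessThan_iff) linarith
  then have "density_support limit_density = {- rsub \<beta>..- rsub q} \<union> {- rsub p..rsub p} \<union> {rsub q..rsub \<beta>}"
    using order by (simp add: density_support_limit_density closure_Un closure_greaterThanLessThan rsub_minus)
  then show ?thesis using order by (intro exI[of _ "rsub q"] exI[of _ "rsub \<beta>"] exI[of _ "rsub p"]) (auto simp: rsub_minus)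
qed

text \<open>Substituting \<open>x = sqrt n * y\<close> moves the sources from
  \<open>\<plusminus> sqrt n * a\<close> to \<open>\<plusminus> a\<close> and changes
  \<open>t\<close> from 1/2 to \<open>1/(2n)\<close>; the nonzero constant factor does not affect
  the zeros.\<close>

lemma sum_multiple_hermite_roots:
  assumes n: "n > 0"
  shows "1 / (3 * real n) * (\<Sum>x | poly (multiple_hermite n (sqrt (real n) * (2 * a))) x = 0. f (x / sqrt (real n))) = emp n f"
proof -
  define \<sigma> where "\<sigma> = sqrt (real n)"
  define H where "H = multiple_hermite n (\<sigma> * (2 * a))"
  have \<sigma>: "\<sigma> > 0" "\<sigma>\<^sup>2 = real n" using n by (simp_all add: \<sigma>_def)
  have "H = herm (1 / 2) (hermite_points n {- (\<sigma> * a), 0, \<sigma> * a})"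
    using \<sigma> a_pos unfolding H_def by (subst multiple_hermite_eq) (auto simp: mult.assoc)
  moreover have "image_mset (\<lambda>\<alpha>. \<alpha> / \<sigma>) (hermite_points n {- (\<sigma> * a), 0, \<sigma> * a}) = hermite_points n {- a, 0, a}"
  proof -
    have "image_mset g (repeat_mset n M) = repeat_mset n (image_mset g M)" for g :: "real \<Rightarrow> real" and M
      by (induction n) auto
    then show ?thesis
      using \<sigma> a_pos by (simp add: hermite_points_def image_mset_mset_set inj_on_def)
  qed
  ultimately have H: "pcompose H [:0, \<sigma>:] =
      smult (\<sigma> ^ size (hermite_points n {- (\<sigma> * a), 0, \<sigma> * a})) (herm (1 / (2 * real n)) (hermite_points n {- a, 0, a}))"
    using pcompose_herm_scale[of \<sigma> "1 / 2" "hermite_points n {- (\<sigma> * a), 0, \<sigma> * a}"] \<sigma> by simp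
  have "poly H (\<sigma> * y) = poly (pcompose H [:0, \<sigma>:]) y" for y by (simp add: poly_pcompose mult.commute)
  then have root: "poly H (\<sigma> * y) = 0 \<longleftrightarrow> y \<in> scaled_roots n" for y
    using \<sigma> by (simp add: H scaled_roots_def herm_roots_def)
  have "{x. poly H x = 0} = (\<lambda>y. \<sigma> * y) ` scaled_roots n"
  proof safe
    fix x assume "poly H x = 0"
    then have "x / \<sigma> \<in> scaled_roots n" using root[of "x / \<sigma>"] \<sigma> by simp
    then show "x \<in> (\<lambda>y. \<sigma> * y) ` scaled_roots n" using \<sigma> by (intro image_eqI[of _ _ "x / \<sigma>"]) auto
  qed (simp add: root)
  moreover have "inj_on (\<lambda>y. \<sigma> * y) (scaled_roots n)" using \<sigma> by (auto intro: inj_onI)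
  ultimately have "(\<Sum>x | poly H x = 0. f (x / \<sigma>)) = (\<Sum>y\<in>scaled_roots n. f y)"
    using \<sigma> by (simp add: sum.reindex)
  then show ?thesis unfolding H_def \<sigma>_def emp_def card_A by simp
qed

end

theorem theorem3p2:
  shows "\<exists>cs::real. cs > 0 \<and> \<bar>cs - 4.10938818\<bar> \<le> 5 / 10 ^ 9 \<and>
    (\<forall>ch::real. ch > 0 \<longrightarrow>
      (\<exists>v::real \<Rightarrow> real. prob_density v \<and>
        (\<forall>f::real \<Rightarrow> real. continuous_on UNIV f \<longrightarrow> bounded (range f) \<longrightarrow>
          (\<lambda>n::nat. 1 / (3 * real n) *
             (\<Sum>x | poly (multiple_hermite n (sqrt (real n) * ch)) x = 0. f (x / sqrt (real n))))
          \<longlonglongrightarrow> (\<integral>x. f x * v x \<partial>lborel)) \<and>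
        (ch > cs \<longrightarrow> (\<exists>a b d. 0 < d \<and> d < a \<and> a < b \<and>
           density_support v = {-b..-a} \<union> {-d..d} \<union> {a..b})) \<and>
        (ch < cs \<longrightarrow> (\<exists>b>0. density_support v = {-b..b}))))"
proof (intro exI[of _ "sqrt (2 * gap_min)"] conjI allI impI)
  \<comment> \<open>The critical parameter is \<open>sqrt (2 * gap_min)\<close>: with
    \<open>a = ch/2\<close>, comparing \<open>2 a\<^sup>2\<close> with \<open>gap_min\<close> means
    comparing \<open>ch\<^sup>2\<close> with \<open>2 * gap_min\<close>.\<close>
  have "0 < gap_min" using gap_min_bounds(1) by (rule less_le_trans[rotated]) simp
  then have pos: "0 \<le> 2 * gap_min" by simp
  have lo: "4.109388175 \<le> sqrt (2 * gap_min)"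
    using gap_min_bounds(1) by (intro real_le_rsqrt) simp
  have hi: "sqrt (2 * gap_min) \<le> 4.109388185"
    using gap_min_bounds(2) by (intro real_le_lsqrt pos) simp_all
  show "sqrt (2 * gap_min) > 0" using \<open>0 < gap_min\<close> by simp
  show "\<bar>sqrt (2 * gap_min) - 4.10938818\<bar> \<le> 5 / 10 ^ 9"
    using lo hi by (intro abs_leI) simp_all
  fix ch :: real assume ch: "ch > 0"
  interpret three_sources "ch / 2" by standard (use ch in simp)
  obtain b where b: "b > 0" "\<And>x. \<bar>x\<bar> > b \<Longrightarrow> limit_density x = 0"
    using limit_density_compact_support by blast
  have sq: "2 * (ch / 2)\<^sup>2 = ch\<^sup>2 / 2" by (simp add: power2_eq_square)
  show "\<exists>v::real \<Rightarrow> real. prob_density v \<and>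
        (\<forall>f::real \<Rightarrow> real. continuous_on UNIV f \<longrightarrow> bounded (range f) \<longrightarrow>
          (\<lambda>n::nat. 1 / (3 * real n) *
             (\<Sum>x | poly (multiple_hermite n (sqrt (real n) * ch)) x = 0. f (x / sqrt (real n))))
          \<longlonglongrightarrow> (\<integral>x. f x * v x \<partial>lborel)) \<and>
        (ch > sqrt (2 * gap_min) \<longrightarrow> (\<exists>a b d. 0 < d \<and> d < a \<and> a < b \<and>
           density_support v = {-b..-a} \<union> {-d..d} \<union> {a..b})) \<and>
        (ch < sqrt (2 * gap_min) \<longrightarrow> (\<exists>b>0. density_support v = {-b..b}))"
  proof (intro exI[of _ limit_density] conjI allI impI)
    show "prob_density limit_density" by (rule prob_density_limit_density[OF b(2)]) auto
  next
    fix f :: "real \<Rightarrow> real" assume f: "continuous_on UNIV f" "bounded (range f)"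
    then obtain B where B: "\<And>x. \<bar>f x\<bar> \<le> B" by (auto simp: bounded_iff)
    have "(\<lambda>n. emp n f) \<longlonglongrightarrow> (\<integral>x. f x * limit_density x \<partial>lborel)"
      by (rule emp_tendsto[OF b(2) _ f(1) B]) auto
    \<comment> \<open>The two averages agree for \<open>n > 0\<close>, which is enough for the
      limit.\<close>
    then show "(\<lambda>n::nat. 1 / (3 * real n) *
         (\<Sum>x | poly (multiple_hermite n (sqrt (real n) * ch)) x = 0. f (x / sqrt (real n))))
        \<longlonglongrightarrow> (\<integral>x. f x * limit_density x \<partial>lborel)"
      by (rule Lim_transform_eventually)
        (use sum_multiple_hermite_roots[of _ f] in \<open>auto intro!: eventually_mono[OF eventually_gt_at_top[of 0]]\<close>)
  next
    assume "ch > sqrt (2 * gap_min)"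
    then have "2 * gap_min < ch\<^sup>2" using real_less_rsqrt not_le by (metis ch less_le real_le_rsqrt)
    then show "\<exists>a b d. 0 < d \<and> d < a \<and> a < b \<and> density_support limit_density = {-b..-a} \<union> {-d..d} \<union> {a..b}"
      by (intro three_intervals) (simp add: sq)
  next
    assume "ch < sqrt (2 * gap_min)"
    then have "ch\<^sup>2 < 2 * gap_min" using ch by (metis less_eq_real_def not_le real_le_lsqrt real_sqrt_le_iff real_sqrt_unique)
    then show "\<exists>b>0. density_support limit_density = {-b..b}"
      by (intro one_interval) (simp add: sq)
  qed
qed

end
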